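(* Let $X$ be a path-connected space and $x_0\in X$. Suppose $\mathbf{w}(X)$ is totally path disconnected and $N\trianglelefteq\pi_1(X,x_0)$ is a normal subgroup. Then $N$ is $(D,d_\infty)$-closed if and only if $N$ is $(W,w_\infty)$-closed. In particular, the closure operators $cl_{D,d_\infty}$ and $cl_{W,w_\infty}$ agree on the normal subgroups of $\pi_1(X,x_0)$.
   Context: A map is a continuous function; $f_{\#}$ denotes the homomorphism induced on fundamental groups. For paths, $\alpha\cdot\beta$ is concatenation and $\alpha^{-}$ the reverse path; restrictions of paths to subintervals are regarded as paths via linear reparametrization. $\mathbf{w}(X)\subseteq X$ is the subspace of points at which $X$ is not semilocally simply connected, i.e. points $x$ having no open neighborhood $U$ for which $\pi_1(U,x)\to\pi_1(X,x)$ is trivial. A space is totally path disconnected if every path in it is constant. Closed subgroups and closure: for a based space $(\mathbb{T},t_0)$, a subgroup $T\leq\pi_1(\mathbb{T},t_0)$ and $g\in\pi_1(\mathbb{T},t_0)$, a subgroup $H\leq\pi_1(X,x_0)$ is $(T,g)$-closed if for every map $f:(\mathbb{T},t_0)\to(X,x_0)$ with $f_{\#}(T)\leq H$ we have $f_{\#}(g)\in H$. The $(T,g)$-closure $cl_{T,g}(H)$ is the intersection of all $(T,g)$-closed subgroups of $\pi_1(X,x_0)$ containing $H$. The test space $\mathbb{D}$: for integers $n\geq1$, $1\leq j\leq 2^{n-1}$ let $\mathbb{D}(n,j)=\{(x,y)\in\mathbb{R}^2\mid (x-\frac{2j-1}{2^n})^2+y^2=(\frac1{2^n})^2,\ y\geq0\}$,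 and let $\mathbb{D}=([0,1]\times\{0\})\cup\bigcup_{n,j}\mathbb{D}(n,j)\subseteq\mathbb{R}^2$ with basepoint $d_0=(0,0)$. Let $\ell_{n,j}(t)=\left(\frac{t+j-1}{2^{n-1}},\frac{1}{2^{n-1}}\sqrt{t-t^2}\right)$, $t\in[0,1]$; the paths $\ell_{n,j}$ and $\ell_{n,j}^{-}$ are called standard. Let $\lambda_1=\ell_{1,1}$ and $\lambda_\infty(t)=(t,0)$. $D\leq\pi_1(\mathbb{D},d_0)$ is the subgroup of homotopy classes of loops at $d_0$ that are finite concatenations of standard paths, and $d_\infty=[\lambda_1\cdot\lambda_\infty^{-}]$. The test space $\mathbb{W}$: let $\mathcal{C}\subseteq[0,1]$ be the standard middle third Cantor set and $\mathcal{I}$ the set of components of $[0,1]\setminus\mathcal{C}$. For $I=(a,b)\in\mathcal{I}$ let $\mathbb{W}_I\subseteq\mathbb{R}^2$ be the upper half of the circle with diameter $[a,b]\times\{0\}$. Let $\mathbb{W}=([0,1]\times\{0\})\cup\bigcup_{I\in\mathcal{I}}\mathbb{W}_I\subseteq\mathbb{R}^2$ with basepoint $d_0=(0,0)$. Let $\lambda_\infty:[0,1]\to\mathbb{W}$, $\lambda_\infty(t)=(t,0)$, and let $\upsilon_\infty:[0,1]\to\mathbb{W}$ be the arc with $\upsilon_\infty(t)=(t,0)$ for $t\in\mathcal{C}$ and, for $I=(a,b)\in\mathcal{I}$, $\upsilon_\infty|_{[a,b]}$ the arc along $\mathbb{W}_I$ from $(a,0)$ to $(b,0)$. $W\leq\pi_1(\mathbb{W},d_0)$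 is generated by $\{[\upsilon_\infty|_{[0,b]}\cdot\lambda_\infty|_{[a,b]}^{-}\cdot\upsilon_\infty|_{[0,a]}^{-}]\mid(a,b)\in\mathcal{I}\}$, and $w_\infty=[\upsilon_\infty\cdot\lambda_\infty^{-}]$. *)

theory Defs
  imports "HOL-Analysis.Analysis" "HOL-Algebra.Generated_Groups"
begin

section \<open>Fundamental groups\<close>

text \<open>
  Spaces are subsets of a topological type, with the subspace topology. Only the restriction to
  [0,1] of a function representing a path matters: \<^const>\<open>homotopic_paths\<close> identifies functions
  agreeing there.
\<close>

definition loops_at :: "'a::topological_space set \<Rightarrow> 'a \<Rightarrow> (real \<Rightarrow> 'a) set" where
  "loops_at X x =
    {p. path p \<and> path_image p \<subseteq> X \<and> pathstart p = x \<and> pathfinish p = x}"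

definition path_class :: "'a::topological_space set \<Rightarrow> (real \<Rightarrow> 'a) \<Rightarrow> (real \<Rightarrow> 'a) set" where
  "path_class X p = {q. homotopic_paths X p q}"

definition fundamental_group ::
    "'a::topological_space set \<Rightarrow> 'a \<Rightarrow> (real \<Rightarrow> 'a) set monoid" where
  "fundamental_group X x =
    \<lparr>carrier = path_class X ` loops_at X x,
     mult = (\<lambda>A B. \<Union>p\<in>A. \<Union>q\<in>B. path_class X (p +++ q)),
     one = path_class X (\<lambda>t. x)\<rparr>"

text \<open>
  The homomorphism induced by f into the fundamental group of Y. The union is over the
  representatives of a class, whose images are all homotopic.
\<close>

definition induced_hom ::
    "'b::topological_space set \<Rightarrow> ('a::topological_space \<Rightarrow> 'b) \<Rightarrow> (real \<Rightarrow> 'a) set \<Rightarrow> (real \<Rightarrow> 'b) set"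
  where "induced_hom Y f A = (\<Union>p\<in>A. path_class Y (f \<circ> p))"

definition non_slsc_points :: "'a::topological_space set \<Rightarrow> 'a set" where
  "non_slsc_points X =
    {x \<in> X. \<not> (\<exists>U. openin (top_of_set X) U \<and> x \<in> U \<and>
       induced_hom X id ` carrier (fundamental_group U x) = {\<one>\<^bsub>fundamental_group X x\<^esub>})}"

definition totally_path_disconnected :: "'a::topological_space set \<Rightarrow> bool" where
  "totally_path_disconnected S \<longleftrightarrow>
    (\<forall>p. path p \<and> path_image p \<subseteq> S \<longrightarrow> (\<exists>c. \<forall>t\<in>{0..1}. p t = c))"


section \<open>Closed subgroups and closure\<close>

definition closed_subgroup ::
    "'t::topological_space set \<Rightarrow> 't \<Rightarrow> (real \<Rightarrow> 't) set set \<Rightarrow> (real \<Rightarrow> 't) set \<Rightarrow>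
     'a::topological_space set \<Rightarrow> 'a \<Rightarrow> (real \<Rightarrow> 'a) set set \<Rightarrow> bool" where
  "closed_subgroup TT t0 T g X x0 H \<longleftrightarrow>
    subgroup H (fundamental_group X x0) \<and>
    (\<forall>f. continuous_on TT f \<and> f ` TT \<subseteq> X \<and> f t0 = x0 \<and> induced_hom X f ` T \<subseteq> H
       \<longrightarrow> induced_hom X f g \<in> H)"

definition subgroup_closure ::
    "'t::topological_space set \<Rightarrow> 't \<Rightarrow> (real \<Rightarrow> 't) set set \<Rightarrow> (real \<Rightarrow> 't) set \<Rightarrow>
     'a::topological_space set \<Rightarrow> 'a \<Rightarrow> (real \<Rightarrow> 'a) set set \<Rightarrow> (real \<Rightarrow> 'a) set set" where
  "subgroup_closure TT t0 T g X x0 H = \<Inter> {K. closed_subgroup TT t0 T g X x0 K \<and> H \<subseteq> K}"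


section \<open>Test spaces\<close>

definition d0 :: "real \<times> real" where
  "d0 = (0, 0)"

definition lambda_inf :: "real \<Rightarrow> real \<times> real" where
  "lambda_inf t = (t, 0)"

definition upper_semicircle :: "real \<Rightarrow> real \<Rightarrow> (real \<times> real) set" where
  "upper_semicircle c r = {(x, y). (x - c)\<^sup>2 + y\<^sup>2 = r\<^sup>2 \<and> y \<ge> 0}"


subsection \<open>Dyadic arcs\<close>

definition dyadic_index :: "(nat \<times> nat) set" where
  "dyadic_index = {(n, j). 1 \<le> n \<and> 1 \<le> j \<and> j \<le> 2 ^ (n - 1)}"

definition DD :: "(real \<times> real) set" where
  "DD = {0..1} \<times> {0} \<union>
    (\<Union>(n, j)\<in>dyadic_index. upper_semicircle ((2 * real j - 1) / 2 ^ n) (1 / 2 ^ n))"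

definition dyadic_path :: "nat \<Rightarrow> nat \<Rightarrow> real \<Rightarrow> real \<times> real" where
  "dyadic_path n j t =
    ((t + real j - 1) / 2 ^ (n - 1), 1 / 2 ^ (n - 1) * sqrt (t - t\<^sup>2))"

definition standard_paths :: "(real \<Rightarrow> real \<times> real) set" where
  "standard_paths =
    (\<Union>(n, j)\<in>dyadic_index. {dyadic_path n j, reversepath (dyadic_path n j)})"

text \<open>
  Omitting the empty concatenation loses no homotopy class: a standard path followed by
  its reverse is null-homotopic.
\<close>

inductive_set finite_concatenations :: "(real \<Rightarrow> real \<times> real) set" where
  single: "p \<in> standard_paths \<Longrightarrow> p \<in> finite_concatenations"
| join: "\<lbrakk>p \<in> standard_paths; q \<in> finite_concatenations; pathfinish p = pathstart q\<rbrakk>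
    \<Longrightarrow> p +++ q \<in> finite_concatenations"

definition D_subgroup :: "(real \<Rightarrow> real \<times> real) set set" where
  "D_subgroup = path_class DD ` (finite_concatenations \<inter> loops_at DD d0)"

definition d_inf :: "(real \<Rightarrow> real \<times> real) set" where
  "d_inf = path_class DD (dyadic_path 1 1 +++ reversepath lambda_inf)"


subsection \<open>Arcs over the gaps of the Cantor set\<close>

primrec cantor_stage :: "nat \<Rightarrow> real set" where
  "cantor_stage 0 = {0..1}"
| "cantor_stage (Suc n) =
    (\<lambda>x. x / 3) ` cantor_stage n \<union> (\<lambda>x. (x + 2) / 3) ` cantor_stage n"

definition cantor_set :: "real set" where
  "cantor_set = (\<Inter>n. cantor_stage n)"

text \<open>Endpoint pairs of the components of the complement; these are all open intervals.\<close>

definition cantor_gaps :: "(real \<times> real) set" where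
  "cantor_gaps = {(a, b). a < b \<and> {a<..<b} \<in> components ({0..1} - cantor_set)}"

definition WW :: "(real \<times> real) set" where
  "WW = {0..1} \<times> {0} \<union>
    (\<Union>(a, b)\<in>cantor_gaps. upper_semicircle ((a + b) / 2) ((b - a) / 2))"

text \<open>
  Over a gap (a,b), the semicircle is parametrized by its first coordinate.
\<close>

definition upsilon_inf :: "real \<Rightarrow> real \<times> real" where
  "upsilon_inf t =
    (if t \<in> cantor_set then (t, 0)
     else let (a, b) = (THE I. I \<in> cantor_gaps \<and> fst I < t \<and> t < snd I)
          in (t, sqrt ((t - a) * (b - t))))"

definition W_subgroup :: "(real \<Rightarrow> real \<times> real) set set" where
  "W_subgroup = generate (fundamental_group WW d0)
    {path_class WW (subpath 0 b upsilon_inf +++ reversepath (subpath a b lambda_inf)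
                    +++ reversepath (subpath 0 a upsilon_inf)) | a b. (a, b) \<in> cantor_gaps}"

definition w_inf :: "(real \<Rightarrow> real \<times> real) set" where
  "w_inf = path_class WW (upsilon_inf +++ reversepath lambda_inf)"

end

theory Submission
  imports Defs
begin

text \<open>
  The two test pairs simulate each other. There are maps of based spaces from \<^const>\<open>DD\<close> to \<^const>\<open>WW\<close>
  and from \<^const>\<open>WW\<close> to \<^const>\<open>DD\<close> that carry the distinguished subgroups into each other and exchange
  the elements \<^const>\<open>d_inf\<close> and \<^const>\<open>w_inf\<close>. Precomposing test maps with them
  (\<open>closed_subgroup_pullback\<close>) shows that exactly the same subgroups are closed for both pairs
  (\<open>closed_D_iff_closed_W\<close>), and then both closure operators intersect the same families.

  From \<^const>\<open>DD\<close> to \<^const>\<open>WW\<close> (\<open>D_to_W\<close>): keep the first coordinate, fix the base, and send the arc over a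
  dyadic interval [u,v] to the path that follows the semicircles over the gaps contained in [u,v] and
  the base elsewhere. The big arc goes to \<^const>\<open>upsilon_inf\<close>. When [0,v] is subdivided at u, the
  two parts miss at most one gap of [0,v], the one that contains u, and crossing a single gap along the
  base instead of along its semicircle changes a path by a generator of \<^const>\<open>W_subgroup\<close>. Hence loops
  composed of standard paths go into \<^const>\<open>W_subgroup\<close>.

  From \<^const>\<open>WW\<close> to \<^const>\<open>DD\<close> (\<open>W_to_D\<close>): collapse the base by the Cantor function, which takes the gaps to
  the dyadic midpoints. Let \<open>l\<close> be the arc over a dyadic interval and \<open>a\<close>, \<open>b\<close> the arcs over its two
  halves. Send the semicircle over the corresponding gap to the loop \<open>a\<^sup>- l b\<^sup>-\<close> at the midpoint.
  The point is that the resulting path over all of [0,1], with its infinitely many loops, is homotopic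
  to the big arc \<open>l\<close>: the arc \<open>l\<close> is homotopic to \<open>a (a\<^sup>- l b\<^sup>-) b\<close>, the same can be done with the outer
  factors \<open>a\<close> and \<open>b\<close>, and since the arcs shrink, these homotopies, carried out in successively shorter
  times, fit together to a homotopy to the limit path (\<open>infinite_refinement\<close>). Thus \<^const>\<open>w_inf\<close> goes to
  \<^const>\<open>d_inf\<close>. The same argument over smaller intervals shows that the part of the path up to a gap is
  homotopic to a finite concatenation of standard paths, so that the generators of
  \<^const>\<open>W_subgroup\<close> go into \<^const>\<open>D_subgroup\<close>.
\<close>

section \<open>Fundamental groups and maps of test spaces\<close>

lemma path_class_cong: "homotopic_paths X p q \<Longrightarrow> path_class X p = path_class X q"
  unfolding path_class_def by (auto intro: homotopic_paths_trans homotopic_paths_sym)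

lemma induced_hom_path_class:
  assumes "continuous_on X f" "f ` X \<subseteq> Y" "path p" "path_image p \<subseteq> X"
  shows "induced_hom Y f (path_class X p) = path_class Y (f \<circ> p)"
proof -
  have "path_class Y (f \<circ> q) = path_class Y (f \<circ> p)" if "homotopic_paths X p q" for q
    by (rule path_class_cong[symmetric], rule homotopic_paths_continuous_image[OF that])
       (use assms in auto)
  then have eq: "path_class Y (f \<circ> q) = path_class Y (f \<circ> p)" if "q \<in> path_class X p" for q
    using that by (simp add: path_class_def)
  have "p \<in> path_class X p" using assms by (simp add: path_class_def)
  then show ?thesis unfolding induced_hom_def using eq by blast
qed

lemma loops_atI:
  "\<lbrakk>path p; path_image p \<subseteq> X; pathstart p = x; pathfinish p = x\<rbrakk> \<Longrightarrow> p \<in> loops_at X x"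
  by (simp add: loops_at_def)

lemma loops_at_join: "\<lbrakk>p \<in> loops_at X x; q \<in> loops_at X x\<rbrakk> \<Longrightarrow> p +++ q \<in> loops_at X x"
  unfolding loops_at_def by (auto simp: path_image_join)

lemma loops_at_reversepath: "p \<in> loops_at X x \<Longrightarrow> reversepath p \<in> loops_at X x"
  unfolding loops_at_def by auto

lemma path_class_mult:
  assumes "p \<in> loops_at X x" "q \<in> loops_at X x"
  shows "path_class X p \<otimes>\<^bsub>fundamental_group X x\<^esub> path_class X q = path_class X (p +++ q)"
proof -
  have "path_class X (p' +++ q') = path_class X (p +++ q)"
    if "homotopic_paths X p p'" "homotopic_paths X q q'" for p' q'
    by (rule path_class_cong[symmetric], rule homotopic_paths_join[OF that])
       (use assms in \<open>auto simp: loops_at_def\<close>)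
  then have eq: "path_class X (p' +++ q') = path_class X (p +++ q)"
    if "p' \<in> path_class X p" "q' \<in> path_class X q" for p' q'
    using that by (simp add: path_class_def)
  have "p \<in> path_class X p" "q \<in> path_class X q"
    using assms by (auto simp: path_class_def loops_at_def)
  then have "(\<Union>p'\<in>path_class X p. \<Union>q'\<in>path_class X q. path_class X (p' +++ q'))
      = path_class X (p +++ q)"
    using eq by blast
  then show ?thesis by (simp add: fundamental_group_def)
qed

lemma fundamental_group_carrier:
  "A \<in> carrier (fundamental_group X x) \<longleftrightarrow> (\<exists>p\<in>loops_at X x. A = path_class X p)"
  by (auto simp: fundamental_group_def)

lemma fundamental_group_one: "\<one>\<^bsub>fundamental_group X x\<^esub> = path_class X (\<lambda>t. x)"
  by (simp add: fundamental_group_def)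

lemma const_loop: "x \<in> X \<Longrightarrow> (\<lambda>t. x) \<in> loops_at X x"
  by (auto simp: loops_at_def path_def path_image_def pathstart_def pathfinish_def)

lemma linepath_const: "linepath x x = (\<lambda>t. x)"
  by (simp add: linepath_def scaleR_left_diff_distrib)

lemma fundamental_group_inverse:
  fixes X :: "'a::real_normed_vector set"
  assumes "p \<in> loops_at X x"
  shows "path_class X (reversepath p) \<otimes>\<^bsub>fundamental_group X x\<^esub> path_class X p
       = \<one>\<^bsub>fundamental_group X x\<^esub>"
  using assms homotopic_paths_linv[of p X]
  by (auto simp: path_class_mult loops_at_reversepath fundamental_group_one loops_at_def
      linepath_const intro!: path_class_cong)

lemma group_fundamental_group:
  fixes X :: "'a::real_normed_vector set"
  assumes x: "x \<in> X"
  shows "group (fundamental_group X x)"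
proof (rule groupI)
  let ?G = "fundamental_group X x"
  show "\<one>\<^bsub>?G\<^esub> \<in> carrier ?G"
    using const_loop[OF x] by (auto simp: fundamental_group_carrier fundamental_group_one)
  fix A assume "A \<in> carrier ?G"
  then obtain p where p: "p \<in> loops_at X x" "A = path_class X p"
    by (auto simp: fundamental_group_carrier)
  show "\<one>\<^bsub>?G\<^esub> \<otimes>\<^bsub>?G\<^esub> A = A"
    using p const_loop[OF x] homotopic_paths_lid[of p X]
    by (auto simp: fundamental_group_one path_class_mult loops_at_def linepath_const
        intro!: path_class_cong)
  have "path_class X (reversepath p) \<in> carrier ?G"
    using loops_at_reversepath[OF p(1)] by (auto simp: fundamental_group_carrier)
  with fundamental_group_inverse[OF p(1)]
  show "\<exists>B\<in>carrier ?G. B \<otimes>\<^bsub>?G\<^esub> A = \<one>\<^bsub>?G\<^esub>"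
    unfolding p(2) by (rule bexI)
  fix B assume "B \<in> carrier ?G"
  then obtain q where q: "q \<in> loops_at X x" "B = path_class X q"
    by (auto simp: fundamental_group_carrier)
  show "A \<otimes>\<^bsub>?G\<^esub> B \<in> carrier ?G"
    using p q loops_at_join[OF p(1) q(1)] by (auto simp: fundamental_group_carrier path_class_mult)
  fix C assume "C \<in> carrier ?G"
  then obtain r where r: "r \<in> loops_at X x" "C = path_class X r"
    by (auto simp: fundamental_group_carrier)
  show "A \<otimes>\<^bsub>?G\<^esub> B \<otimes>\<^bsub>?G\<^esub> C = A \<otimes>\<^bsub>?G\<^esub> (B \<otimes>\<^bsub>?G\<^esub> C)"
  proof -
    have "homotopic_paths X (p +++ (q +++ r)) ((p +++ q) +++ r)"
      using p(1) q(1) r(1) by (intro homotopic_paths_assoc) (auto simp: loops_at_def)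
    then show ?thesis
      using p q r by (simp add: path_class_mult loops_at_join path_class_cong)
  qed
qed

lemma fundamental_group_inv:
  fixes X :: "'a::real_normed_vector set"
  assumes "p \<in> loops_at X x"
  shows "inv\<^bsub>fundamental_group X x\<^esub> (path_class X p) = path_class X (reversepath p)"
proof -
  have "x \<in> X" using assms by (force simp: loops_at_def path_image_def pathstart_def)
  then interpret group "fundamental_group X x" by (rule group_fundamental_group)
  show ?thesis
    using assms loops_at_reversepath[OF assms]
    by (intro inv_equality fundamental_group_inverse) (auto simp: fundamental_group_carrier)
qed

text \<open>
  A map of test spaces that carries the subgroup of the first into the subgroup of the second, and
  the distinguished element to the distinguished element, transfers closedness: every test map out
  of the second space can be precomposed with it.
\<close>

lemma closed_subgroup_pullback:
  assumes closed: "closed_subgroup TT t0 T g X x0 H"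
    and k: "continuous_on TT k" "k ` TT \<subseteq> TT'" "k t0 = t0'"
    and T: "\<And>A. A \<in> T \<Longrightarrow> \<exists>p\<in>loops_at TT t0. A = path_class TT p \<and> path_class TT' (k \<circ> p) \<in> T'"
    and g: "g = path_class TT p" "p \<in> loops_at TT t0" "g' = path_class TT' (k \<circ> p)"
  shows "closed_subgroup TT' t0' T' g' X x0 H"
  unfolding closed_subgroup_def
proof (intro conjI allI impI)
  show "subgroup H (fundamental_group X x0)" using closed by (simp add: closed_subgroup_def)
  fix f assume f: "continuous_on TT' f \<and> f ` TT' \<subseteq> X \<and> f t0' = x0 \<and> induced_hom X f ` T' \<subseteq> H"
  have fk: "continuous_on TT (f \<circ> k)" "(f \<circ> k) ` TT \<subseteq> X" "(f \<circ> k) t0 = x0"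
    using k f continuous_on_compose[of TT k f] continuous_on_subset[of TT' f "k ` TT"] by auto
  have eq: "induced_hom X (f \<circ> k) (path_class TT q) = induced_hom X f (path_class TT' (k \<circ> q))"
    if "q \<in> loops_at TT t0" for q
  proof -
    have q: "path q" "path_image q \<subseteq> TT" using that by (auto simp: loops_at_def)
    have kq: "path (k \<circ> q)" "path_image (k \<circ> q) \<subseteq> TT'"
      using q k by (auto intro!: path_continuous_image elim: continuous_on_subset
          simp: path_image_compose)
    show ?thesis
      using induced_hom_path_class[OF fk(1,2) q] induced_hom_path_class[of TT' f X "k \<circ> q"] f kq
      by (simp add: comp_assoc)
  qed
  have "induced_hom X (f \<circ> k) ` T \<subseteq> H"
  proof safe
    fix A assume "A \<in> T"
    then obtain q where "q \<in> loops_at TT t0" "A = path_class TT q" "path_class TT' (k \<circ> q) \<in> T'"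
      using T by blast
    then show "induced_hom X (f \<circ> k) A \<in> H" using eq[of q] f by auto
  qed
  then have "induced_hom X (f \<circ> k) g \<in> H"
    using closed fk by (simp add: closed_subgroup_def)
  then show "induced_hom X f g' \<in> H" using eq g by simp
qed

section \<open>Self-similar paths by infinite refinement\<close>

text \<open>
  The two similarities that map \<^const>\<open>DD\<close> onto its parts below the left and the right semicircle
  of the second generation. They send standard paths to standard paths.
\<close>

definition left_half :: "real \<times> real \<Rightarrow> real \<times> real" where
  "left_half p = (fst p / 2, snd p / 2)"

definition right_half :: "real \<times> real \<Rightarrow> real \<times> real" where
  "right_half p = ((fst p + 1) / 2, snd p / 2)"

text \<open>
  One stage of the construction of the Cantor function, for paths: a copy of P at half size over each
  outer third, and M over the middle third. Fixed points of this operation are self-similar paths;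
  the Cantor function itself is the case where M is constant.
\<close>

definition cantor_join ::
  "(real \<Rightarrow> real \<times> real) \<Rightarrow> (real \<Rightarrow> real \<times> real) \<Rightarrow> real \<Rightarrow> real \<times> real" where
  "cantor_join M P t =
    (if t \<le> 1/3 then left_half (P (3 * t)) else if t \<le> 2/3 then M (3 * t - 1)
     else right_half (P (3 * t - 2)))"

lemma continuous_on_left_half [continuous_intros]:
  "continuous_on S f \<Longrightarrow> continuous_on S (\<lambda>x. left_half (f x))"
  unfolding left_half_def by (intro continuous_intros) auto

lemma continuous_on_right_half [continuous_intros]:
  "continuous_on S f \<Longrightarrow> continuous_on S (\<lambda>x. right_half (f x))"
  unfolding right_half_def by (intro continuous_intros) auto

lemma tendsto_left_half [tendsto_intros]:
  "(f \<longlongrightarrow> l) F \<Longrightarrow> ((\<lambda>x. left_half (f x)) \<longlongrightarrow> left_half l) F"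
  unfolding left_half_def by (intro tendsto_intros) auto

lemma tendsto_right_half [tendsto_intros]:
  "(f \<longlongrightarrow> l) F \<Longrightarrow> ((\<lambda>x. right_half (f x)) \<longlongrightarrow> right_half l) F"
  unfolding right_half_def by (intro tendsto_intros) auto

lemma left_half_diff: "left_half p - left_half q = (1/2) *\<^sub>R (p - q)"
  and right_half_diff: "right_half p - right_half q = (1/2) *\<^sub>R (p - q)"
  by (auto simp: left_half_def right_half_def prod_eq_iff field_simps)

lemma cantor_join_diff:
  assumes "t \<in> {0..1}" "\<And>u. u \<in> {0..1} \<Longrightarrow> norm (P u - Q u) \<le> e" "0 \<le> e"
  shows "norm (cantor_join M P t - cantor_join M Q t) \<le> e / 2"
proof -
  consider "t \<le> 1/3" | "1/3 < t" "t \<le> 2/3" | "2/3 < t" by linarith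
  then show ?thesis
    using assms(1,3) assms(2)[of "3*t"] assms(2)[of "3*t-2"]
    by cases (auto simp: cantor_join_def left_half_diff right_half_diff)
qed

text \<open>
  If P is homotopic to its refinement, then it is homotopic to the infinitely iterated refinement.
  The homotopy is itself obtained as a fixed point. Run the given homotopy H from P to its refinement during the
  first half of the time; during the second half run, over each outer third, a half-size copy of the
  whole homotopy that is being constructed. This prescription \<Psi> halves distances because the
  similarities do, so its iterates converge uniformly to a continuous map, and at time 1 the equation
  for the fixed point of \<Psi> says that the final path is its own refinement.
\<close>

lemma infinite_refinement:
  assumes S: "closed S" "bounded S" "left_half ` S \<subseteq> S" "right_half ` S \<subseteq> S"
    and M: "path M" "path_image M \<subseteq> S" "pathstart M = (1/2, 0)" "pathfinish M = (1/2, 0)"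
    and P: "pathstart P = (0, 0)" "pathfinish P = (1, 0)"
    and hom: "homotopic_paths S P (cantor_join M P)"
  obtains T where "homotopic_paths S P T" "\<And>t. t \<in> {0..1} \<Longrightarrow> T t = cantor_join M T t"
proof -
  define I where "I = {0..1::real}"
  obtain H where H: "continuous_on (I \<times> I) H" "H \<in> (I \<times> I) \<rightarrow> S"
    "\<And>x. x \<in> I \<Longrightarrow> H (0, x) = P x" "\<And>x. x \<in> I \<Longrightarrow> H (1, x) = cantor_join M P x"
    "\<And>s. s \<in> I \<Longrightarrow> H (s, 0) = (0,0)" "\<And>s. s \<in> I \<Longrightarrow> H (s, 1) = (1,0)"
    using hom P unfolding homotopic_paths I_def pathstart_def pathfinish_def by auto
  have M': "continuous_on I M" "\<And>t. t \<in> I \<Longrightarrow> M t \<in> S" "M 0 = (1/2, 0)" "M 1 = (1/2, 0)"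
    using M by (auto simp: path_def path_image_def pathstart_def pathfinish_def I_def)
  have P': "P 0 = (0,0)" "P 1 = (1,0)" "\<And>t. t \<in> I \<Longrightarrow> P t \<in> S" "continuous_on I P"
    using P homotopic_paths_imp_path[OF hom] homotopic_paths_imp_subset[OF hom]
    by (auto simp: path_def path_image_def pathstart_def pathfinish_def I_def)
  define \<Psi> where "\<Psi> K = (\<lambda>z. if fst z \<le> 1/2 then H (2 * fst z, snd z)
      else cantor_join M (\<lambda>u. K (2 * fst z - 1, u)) (snd z))" for K :: "real \<times> real \<Rightarrow> real \<times> real"
  define good where "good K \<longleftrightarrow> continuous_on (I \<times> I) K \<and> (\<forall>z\<in>I \<times> I. K z \<in> S) \<and>
      (\<forall>s\<in>I. K (s, 0) = (0,0) \<and> K (s, 1) = (1,0)) \<and> (\<forall>t\<in>I. K (0, t) = P t)"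
    for K :: "real \<times> real \<Rightarrow> real \<times> real"
  \<comment> \<open>The pieces fit together: the copies of K and the path M meet at (1/2,0), and K starts from P, whose refinement is where H ends.\<close>
  have step: "good (\<Psi> K)" if K: "good K" for K
  proof -
    have Kc: "continuous_on A (\<lambda>z. K (f z))" if "continuous_on A f" "f ` A \<subseteq> I \<times> I"
      for A and f :: "real \<times> real \<Rightarrow> _"
      using continuous_on_compose2[of "I \<times> I" K A f] K that by (auto simp: good_def)
    have Mc: "continuous_on A (\<lambda>z. M (f z))" if "continuous_on A f" "f ` A \<subseteq> I"
      for A and f :: "real \<times> real \<Rightarrow> _"
      using continuous_on_compose2[of I M A f] M' that by auto
    have Hc: "continuous_on A (\<lambda>z. H (f z))" if "continuous_on A f" "f ` A \<subseteq> I \<times> I"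
      for A and f :: "real \<times> real \<Rightarrow> _"
      using continuous_on_compose2[of "I \<times> I" H A f] H that by auto
    have K': "K (s, 0) = (0,0)" "K (s, 1) = (1,0)" "K (0, s) = P s" if "s \<in> I" for s
      using K that by (auto simp: good_def)
    have "continuous_on (I \<times> I) (\<Psi> K)"
      unfolding \<Psi>_def cantor_join_def
    proof (intro continuous_on_cases_le continuous_intros)
      show "continuous_on {x \<in> I \<times> I. fst x \<le> 1/2} (\<lambda>x. H (2 * fst x, snd x))"
        by (intro Hc continuous_intros) (auto simp: I_def)
      show "continuous_on {x \<in> {x \<in> I \<times> I. 1/2 \<le> fst x}. snd x \<le> 1/3}
          (\<lambda>x. K (2 * fst x - 1, 3 * snd x))"
        by (intro Kc continuous_intros) (auto simp: I_def)
      show "continuous_on {x \<in> {x \<in> {x \<in> I \<times> I. 1/2 \<le> fst x}. 1/3 \<le> snd x}. snd x \<le> 2/3}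
          (\<lambda>x. M (3 * snd x - 1))"
        by (intro Mc continuous_intros) (auto simp: I_def)
      show "continuous_on {x \<in> {x \<in> {x \<in> I \<times> I. 1/2 \<le> fst x}. 1/3 \<le> snd x}. 2/3 \<le> snd x}
          (\<lambda>x. K (2 * fst x - 1, 3 * snd x - 2))"
        by (intro Kc continuous_intros) (auto simp: I_def)
    next
      fix x :: "real \<times> real"
      assume x: "x \<in> {x \<in> {x \<in> I \<times> I. 1/2 \<le> fst x}. 1/3 \<le> snd x}" "snd x = 2/3"
      then obtain a where "x = (a, 2/3)" "2 * a - 1 \<in> I"
        by (cases x) (auto simp: I_def)
      then show "M (3 * snd x - 1) = right_half (K (2 * fst x - 1, 3 * snd x - 2))"
        by (simp add: M' K' right_half_def)
    next
      fix x :: "real \<times> real"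
      assume x: "x \<in> {x \<in> I \<times> I. 1/2 \<le> fst x}" "snd x = 1/3"
      then obtain a where "x = (a, 1/3)" "2 * a - 1 \<in> I"
        by (cases x) (auto simp: I_def)
      then show "left_half (K (2 * fst x - 1, 3 * snd x)) =
        (if snd x \<le> 2/3 then M (3 * snd x - 1) else right_half (K (2 * fst x - 1, 3 * snd x - 2)))"
        by (simp add: M' K' left_half_def)
    next
      fix x :: "real \<times> real"
      assume x: "x \<in> I \<times> I" "fst x = 1/2"
      then have eq: "2 * fst x = 1" "snd x \<in> I" by auto
      then have "H (2 * fst x, snd x) = cantor_join M P (snd x)"
        using H(4)[of "snd x"] by simp
      also have "\<dots> = (if snd x \<le> 1/3 then left_half (K (2 * fst x - 1, 3 * snd x))
           else if snd x \<le> 2/3 then M (3 * snd x - 1)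
           else right_half (K (2 * fst x - 1, 3 * snd x - 2)))"
        unfolding eq(1) using eq(2) K'(3)[of "3 * snd x"] K'(3)[of "3 * snd x - 2"]
        by (auto simp: cantor_join_def I_def)
      finally show "H (2 * fst x, snd x) = (if snd x \<le> 1/3 then left_half (K (2 * fst x - 1, 3 * snd x))
           else if snd x \<le> 2/3 then M (3 * snd x - 1)
           else right_half (K (2 * fst x - 1, 3 * snd x - 2)))" .
    qed
    moreover have "\<Psi> K z \<in> S" if "z \<in> I \<times> I" for z
      using that K S(3,4) H(2) M'(2)
      unfolding \<Psi>_def cantor_join_def good_def I_def
      by (auto simp: Pi_iff image_subset_iff)
    moreover have "\<Psi> K (s, 0) = (0,0)" "\<Psi> K (s, 1) = (1,0)" if "s \<in> I" for s
      using that H(5,6)[of "2 * s"] K'(1,2)[of "2 * s - 1"]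
      by (auto simp: \<Psi>_def cantor_join_def left_half_def right_half_def I_def)
    moreover have "\<Psi> K (0, t) = P t" if "t \<in> I" for t
      using that H(3)[of t] by (auto simp: \<Psi>_def)
    ultimately show ?thesis unfolding good_def by blast
  qed
  define K where "K n = (\<Psi> ^^ n) (\<lambda>z. P (snd z))" for n
  have KS: "K (Suc n) = \<Psi> (K n)" for n by (simp add: K_def)
  have good: "good (K n)" for n
  proof (induction n)
    case 0
    have "continuous_on (I \<times> I) (\<lambda>z. P (snd z))"
      by (rule continuous_on_compose2[OF P'(4)]) (auto intro!: continuous_intros)
    then show ?case using P' by (auto simp: K_def good_def)
  qed (simp add: KS step)
  obtain B where B: "\<And>x y. x \<in> S \<Longrightarrow> y \<in> S \<Longrightarrow> norm (x - y) \<le> B"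
    using S(2) by (metis bounded_two_points dist_norm)
  have B0: "0 \<le> B" using B[of "P 0" "P 0"] P'(3)[of 0] by (auto simp: I_def)
  have contr: "norm (K (Suc n) z - K n z) \<le> B * (1/2) ^ n" if "z \<in> I \<times> I" for n z
    using that
  proof (induction n arbitrary: z)
    case 0
    then have "K (Suc 0) z \<in> S" "K 0 z \<in> S" using good by (auto simp: good_def)
    from B[OF this] show ?case by simp
  next
    case (Suc n)
    show ?case
    proof (cases "fst z \<le> 1/2")
      case True
      then show ?thesis using B0 by (simp add: KS[of "Suc n"] KS[of n] \<Psi>_def)
    next
      case False
      have "norm (cantor_join M (\<lambda>u. K (Suc n) (2 * fst z - 1, u)) (snd z)
          - cantor_join M (\<lambda>u. K n (2 * fst z - 1, u)) (snd z)) \<le> (B * (1/2) ^ n) / 2"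
        by (rule cantor_join_diff) (use Suc False B0 in \<open>auto simp: I_def\<close>)
      then show ?thesis using False by (simp add: KS[of "Suc n"] KS[of n] \<Psi>_def)
    qed
  qed
  define L where "L z = K 0 z + (\<Sum>i. K (Suc i) z - K i z)" for z
  have "uniform_limit (I \<times> I) (\<lambda>n z. \<Sum>i<n. K (Suc i) z - K i z)
      (\<lambda>z. \<Sum>i. K (Suc i) z - K i z) sequentially"
    by (rule Weierstrass_m_test[OF contr]) (auto intro!: summable_mult summable_geometric)
  then have "uniform_limit (I \<times> I) (\<lambda>n z. K 0 z + (\<Sum>i<n. K (Suc i) z - K i z)) L sequentially"
    unfolding L_def by (intro uniform_limit_intros)
  then have lim: "uniform_limit (I \<times> I) K L sequentially"
    by (simp add: sum_lessThan_telescope[of "\<lambda>i. K i z" for z])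
  have Lc: "continuous_on (I \<times> I) L"
    by (rule uniform_limit_theorem[OF _ lim]) (use good in \<open>auto simp: good_def\<close>)
  have pt: "(\<lambda>n. K n z) \<longlonglongrightarrow> L z" if "z \<in> I \<times> I" for z
    by (rule tendsto_uniform_limitI[OF lim that])
  have LS: "L z \<in> S" if "z \<in> I \<times> I" for z
    by (rule closed_sequentially[OF S(1) _ pt[OF that]]) (use good that in \<open>auto simp: good_def\<close>)
  have L0: "L (s, 0) = (0,0)" "L (s, 1) = (1,0)" "L (0, s) = P s" if "s \<in> I" for s
  proof -
    have "(\<lambda>n. K n (s,0)) = (\<lambda>_. (0,0))" "(\<lambda>n. K n (s,1)) = (\<lambda>_. (1,0))" "(\<lambda>n. K n (0,s)) = (\<lambda>_. P s)"
      using good that by (auto simp: good_def)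
    then show "L (s, 0) = (0,0)" "L (s, 1) = (1,0)" "L (0, s) = P s"
      using pt[of "(s,0)"] pt[of "(s,1)"] pt[of "(0,s)"] that
      by (auto simp: I_def LIMSEQ_const_iff)
  qed
  have fixpt: "L (1, t) = cantor_join M (\<lambda>u. L (1, u)) t" if t: "t \<in> I" for t
  proof -
    have "(\<lambda>n. K (Suc n) (1, t)) \<longlonglongrightarrow> cantor_join M (\<lambda>u. L (1, u)) t"
    proof -
      consider "t \<le> 1/3" | "1/3 < t" "t \<le> 2/3" | "2/3 < t" by linarith
      then show ?thesis
        using t by cases (auto simp: KS \<Psi>_def cantor_join_def I_def intro!: tendsto_intros pt)
    qed
    moreover have "(\<lambda>n. K (Suc n) (1, t)) \<longlonglongrightarrow> L (1, t)"
      by (rule LIMSEQ_Suc, rule pt) (use t in \<open>auto simp: I_def\<close>)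
    ultimately show ?thesis by (rule LIMSEQ_unique[symmetric])
  qed
  have "homotopic_paths S P (\<lambda>t. L (1, t))"
    unfolding homotopic_paths
    by (rule exI[of _ L]) (use Lc LS L0 P in \<open>auto simp: I_def pathstart_def pathfinish_def P'\<close>)
  with fixpt show thesis using that by (auto simp: I_def)
qed

section \<open>The dyadic test space\<close>

text \<open>
  In terms of the end points u and v of the diameter, a point of the semicircle has height the
  geometric mean of its distances to them. This is the form in which heights of arcs over nested
  intervals are compared.
\<close>

lemma upper_semicircle_iff:
  "(x, y) \<in> upper_semicircle ((u + v) / 2) ((v - u) / 2) \<longleftrightarrow> 0 \<le> y \<and> y\<^sup>2 = (x - u) * (v - x)"
  unfolding upper_semicircle_def by (auto simp: power2_eq_square field_simps)

lemma upper_semicircle_bounds: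
  assumes "(x, y) \<in> upper_semicircle ((u + v) / 2) ((v - u) / 2)" "u < v"
  shows "u \<le> x" "x \<le> v" "y = sqrt ((x - u) * (v - x))"
proof -
  have y: "0 \<le> y" "y\<^sup>2 = (x - u) * (v - x)" using assms(1) by (auto simp: upper_semicircle_iff)
  then show "y = sqrt ((x - u) * (v - x))" by (metis real_sqrt_unique)
  have "0 \<le> (x - u) * (v - x)" using y(2) by (metis zero_le_power2)
  then show "u \<le> x" "x \<le> v" using assms(2) by (auto simp: zero_le_mult_iff)
qed

lemma closed_upper_semicircle: "closed (upper_semicircle c r)"
proof -
  have "upper_semicircle c r = {z. (fst z - c)\<^sup>2 + (snd z)\<^sup>2 = r\<^sup>2} \<inter> {z. 0 \<le> snd z}"
    by (auto simp: upper_semicircle_def)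
  also have "closed \<dots>"
    by (intro closed_Int closed_Collect_eq closed_Collect_le continuous_intros)
  finally show ?thesis .
qed

definition dyadic_left :: "nat \<Rightarrow> nat \<Rightarrow> real" where
  "dyadic_left n j = (real j - 1) / 2 ^ (n - 1)"

definition dyadic_right :: "nat \<Rightarrow> nat \<Rightarrow> real" where
  "dyadic_right n j = real j / 2 ^ (n - 1)"

definition dyadic_arc :: "nat \<Rightarrow> nat \<Rightarrow> (real \<times> real) set" where
  "dyadic_arc n j = upper_semicircle ((dyadic_left n j + dyadic_right n j) / 2)
     ((dyadic_right n j - dyadic_left n j) / 2)"

lemma dyadic_length: "dyadic_right n j - dyadic_left n j = 1 / 2 ^ (n - 1)"
  by (simp add: dyadic_left_def dyadic_right_def field_simps)

lemma dyadic_index_bounds: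
  assumes "(n, j) \<in> dyadic_index"
  shows "0 \<le> dyadic_left n j" "dyadic_left n j < dyadic_right n j" "dyadic_right n j \<le> 1"
proof -
  have "real j \<le> 2 ^ (n - 1)" using assms by (auto simp: dyadic_index_def)
  then show "0 \<le> dyadic_left n j" "dyadic_left n j < dyadic_right n j" "dyadic_right n j \<le> 1"
    using assms by (auto simp: dyadic_index_def dyadic_left_def dyadic_right_def field_simps)
qed

lemma dyadic_arc_eq:
  assumes "(n, j) \<in> dyadic_index"
  shows "upper_semicircle ((2 * real j - 1) / 2 ^ n) (1 / 2 ^ n) = dyadic_arc n j"
proof -
  obtain m where m: "n = Suc m" using assms by (cases n) (auto simp: dyadic_index_def)
  have "(dyadic_left n j + dyadic_right n j) / 2 = (2 * real j - 1) / 2 ^ n"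
    "(dyadic_right n j - dyadic_left n j) / 2 = 1 / 2 ^ n"
    by (auto simp: m dyadic_left_def dyadic_right_def field_simps)
  then show ?thesis by (simp only: dyadic_arc_def)
qed

lemma DD_eq: "DD = {0..1} \<times> {0} \<union> (\<Union>(n, j)\<in>dyadic_index. dyadic_arc n j)"
  unfolding DD_def using dyadic_arc_eq by auto

lemma dyadic_arc_iff:
  assumes "(n, j) \<in> dyadic_index"
  shows "(x, y) \<in> dyadic_arc n j \<longleftrightarrow> dyadic_left n j \<le> x \<and> x \<le> dyadic_right n j \<and>
    y = sqrt ((x - dyadic_left n j) * (dyadic_right n j - x))"
  using upper_semicircle_bounds[of x y "dyadic_left n j" "dyadic_right n j"]
    dyadic_index_bounds[OF assms]
  unfolding dyadic_arc_def by (auto simp: upper_semicircle_iff)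

lemma DD_base: "x \<in> {0..1} \<Longrightarrow> (x, 0) \<in> DD" by (auto simp: DD_def)

lemma DD_box: assumes "(x, y) \<in> DD" shows "0 \<le> x" "x \<le> 1" "0 \<le> y" "y \<le> 1"
proof -
  have "0 \<le> x \<and> x \<le> 1 \<and> 0 \<le> y \<and> y \<le> 1"
  proof (cases "y = 0 \<and> x \<in> {0..1}")
    case False
    then obtain n j where nj: "(n, j) \<in> dyadic_index" "(x, y) \<in> dyadic_arc n j"
      using assms by (auto simp: DD_eq)
    have b: "0 \<le> x - dyadic_left n j" "x - dyadic_left n j \<le> 1"
       "0 \<le> dyadic_right n j - x" "dyadic_right n j - x \<le> 1"
      using nj dyadic_index_bounds[OF nj(1)] by (auto simp: dyadic_arc_iff)
    then have "(x - dyadic_left n j) * (dyadic_right n j - x) \<le> 1"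
      by (simp add: mult_le_one)
    with b show ?thesis using nj dyadic_index_bounds[OF nj(1)] by (auto simp: dyadic_arc_iff)
  qed auto
  then show "0 \<le> x" "x \<le> 1" "0 \<le> y" "y \<le> 1" by auto
qed

lemma bounded_DD: "bounded DD"
  by (rule bounded_subset[OF bounded_cbox[of "(0,0)" "(1,1::real)"]])
     (auto simp: cbox_Pair_eq dest: DD_box)

lemma dyadic_arc_height:
  assumes "(n, j) \<in> dyadic_index" "(x, y) \<in> dyadic_arc n j"
  shows "y \<le> 1 / 2 ^ (n - 1)"
proof -
  let ?u = "dyadic_left n j" and ?v = "dyadic_right n j"
  have b: "?u \<le> x" "x \<le> ?v" "y = sqrt ((x - ?u) * (?v - x))"
    using assms by (auto simp: dyadic_arc_iff)
  have "(x - ?u) * (?v - x) \<le> (?v - ?u) * (?v - ?u)" by (intro mult_mono) (use b in auto)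
  then have "y \<le> sqrt ((?v - ?u) * (?v - ?u))" unfolding b(3) by (rule real_sqrt_le_mono)
  then show ?thesis by (simp only: dyadic_length real_sqrt_abs2) simp
qed

text \<open>
  Arcs of generation n have height at most \<open>1 / 2 ^ (n - 1)\<close>, so away from the base only finitely many
  of them occur. Closedness of \<^const>\<open>DD\<close> and continuity of maps out of it reduce to finite unions of
  closed arcs by this fact.
\<close>

lemma DD_locally_finite:
  assumes "0 < e"
  obtains F where "finite F" "F \<subseteq> dyadic_index" "DD \<subseteq> {z. snd z \<le> e} \<union> (\<Union>(n, j)\<in>F. dyadic_arc n j)"
proof -
  obtain N where N: "(1/2::real) ^ N < e" using assms real_arch_pow_inv[of e "1/2"] by auto
  define F where "F = {(n, j) \<in> dyadic_index. n \<le> N}"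
  have "F \<subseteq> (SIGMA n:{..N}. {..2 ^ (n - 1)})" by (auto simp: F_def dyadic_index_def)
  then have "finite F" by (rule finite_subset) auto
  moreover have "snd z \<le> e \<or> (\<exists>(n, j)\<in>F. z \<in> dyadic_arc n j)" if z: "z \<in> DD" for z
  proof (cases "snd z \<le> e")
    case False
    then obtain n j where nj: "(n, j) \<in> dyadic_index" "z \<in> dyadic_arc n j"
      using z assms by (cases z) (auto simp: DD_eq)
    have "n \<le> N"
    proof (rule ccontr)
      assume "\<not> n \<le> N"
      then have "(1/2::real) ^ (n - 1) \<le> (1/2) ^ N" by (intro power_decreasing) auto
      then show False
        using dyadic_arc_height[of n j "fst z" "snd z"] nj N False by (simp add: power_one_over)
    qed
    then show ?thesis using nj by (auto simp: F_def)
  qed auto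
  ultimately show thesis by (intro that[of F]) (auto simp: F_def)
qed

lemma closed_DD: "closed DD"
proof -
  have "p \<in> DD" if p: "p \<in> closure DD" for p
  proof -
    have "closure DD \<subseteq> cbox (0,0) (1,1)"
      by (intro closure_minimal closed_cbox) (auto simp: cbox_Pair_eq dest: DD_box)
    then have box: "fst p \<in> {0..1}" "0 \<le> snd p" using p by (cases p; force simp: cbox_Pair_eq)+
    show ?thesis
    proof (cases "snd p = 0")
      case True
      then show ?thesis using box DD_base[of "fst p"] by (cases p) auto
    next
      case False
      then have pos: "0 < snd p / 2" using box by simp
      obtain F where F: "finite F" "F \<subseteq> dyadic_index"
        "DD \<subseteq> {z. snd z \<le> snd p / 2} \<union> (\<Union>(n, j)\<in>F. dyadic_arc n j)"
        using DD_locally_finite[OF pos] by blast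
      have "closed ({z. snd z \<le> snd p / 2} \<union> (\<Union>(n, j)\<in>F. dyadic_arc n j))"
        using F(1) by (intro closed_Un closed_UN closed_Collect_le continuous_intros)
          (auto simp: dyadic_arc_def closed_upper_semicircle)
      with F(3) p have "p \<in> {z. snd z \<le> snd p / 2} \<union> (\<Union>(n, j)\<in>F. dyadic_arc n j)"
        by (meson closure_minimal subsetD)
      then show ?thesis using pos F(2) by (auto simp: DD_eq)
    qed
  qed
  then show ?thesis by (metis closure_closed closure_subset subsetI subset_antisym closed_closure)
qed

lemma left_half_index: "(n, j) \<in> dyadic_index \<Longrightarrow> (Suc n, j) \<in> dyadic_index"
  and right_half_index: "(n, j) \<in> dyadic_index \<Longrightarrow> (Suc n, j + 2 ^ (n - 1)) \<in> dyadic_index"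
  by (cases n; auto simp: dyadic_index_def)+

lemma left_half_dyadic_path:
  "(n, j) \<in> dyadic_index \<Longrightarrow> left_half \<circ> dyadic_path n j = dyadic_path (Suc n) j"
  and right_half_dyadic_path:
  "(n, j) \<in> dyadic_index \<Longrightarrow> right_half \<circ> dyadic_path n j = dyadic_path (Suc n) (j + 2 ^ (n - 1))"
  by (cases n; auto simp: dyadic_index_def dyadic_path_def left_half_def right_half_def
      field_simps fun_eq_iff)+

lemma left_half_arc: 
  assumes nj: "(n, j) \<in> dyadic_index" and z: "z \<in> dyadic_arc n j"
  shows "left_half z \<in> dyadic_arc (Suc n) j"
  using z nj unfolding dyadic_arc_eq[OF nj, symmetric] dyadic_arc_eq[OF left_half_index[OF nj], symmetric]
  by (cases n) (auto simp: upper_semicircle_def left_half_def power2_eq_square field_simps dyadic_index_def)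

lemma right_half_arc: 
  assumes nj: "(n, j) \<in> dyadic_index" and z: "z \<in> dyadic_arc n j"
  shows "right_half z \<in> dyadic_arc (Suc n) (j + 2 ^ (n - 1))"
  using z nj unfolding dyadic_arc_eq[OF nj, symmetric] dyadic_arc_eq[OF right_half_index[OF nj], symmetric]
  by (cases n) (auto simp: upper_semicircle_def right_half_def power2_eq_square field_simps dyadic_index_def)

lemma left_half_DD: "left_half ` DD \<subseteq> DD"
proof (rule image_subsetI)
  fix z assume z: "z \<in> DD"
  show "left_half z \<in> DD"
  proof (cases "z \<in> {0..1} \<times> {0}")
    case True
    then show ?thesis by (auto simp: left_half_def intro!: DD_base)
  next
    case False
    then obtain n j where nj: "(n, j) \<in> dyadic_index" "z \<in> dyadic_arc n j"
      using z by (auto simp: DD_eq)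
    show ?thesis using left_half_arc[OF nj] left_half_index[OF nj(1)] by (force simp: DD_eq)
  qed
qed

lemma right_half_DD: "right_half ` DD \<subseteq> DD"
proof (rule image_subsetI)
  fix z assume z: "z \<in> DD"
  show "right_half z \<in> DD"
  proof (cases "z \<in> {0..1} \<times> {0}")
    case True
    then show ?thesis by (auto simp: right_half_def intro!: DD_base)
  next
    case False
    then obtain n j where nj: "(n, j) \<in> dyadic_index" "z \<in> dyadic_arc n j"
      using z by (auto simp: DD_eq)
    show ?thesis using right_half_arc[OF nj] right_half_index[OF nj(1)] by (force simp: DD_eq)
  qed
qed

lemma dyadic_path_arc:
  assumes "(n, j) \<in> dyadic_index" "t \<in> {0..1}"
  shows "dyadic_path n j t \<in> dyadic_arc n j"
proof -
  have "dyadic_path n j t = (dyadic_left n j + t / 2 ^ (n - 1), 1 / 2 ^ (n - 1) * sqrt (t - t\<^sup>2))"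
    by (simp add: dyadic_path_def dyadic_left_def field_simps)
  moreover have "1 / 2 ^ (n - 1) * sqrt (t - t\<^sup>2) =
     sqrt ((t / 2 ^ (n - 1)) * ((1 - t) / 2 ^ (n - 1)))"
    by (simp add: real_sqrt_mult real_sqrt_divide power2_eq_square algebra_simps)
  moreover have "dyadic_right n j = dyadic_left n j + 1 / 2 ^ (n - 1)" 
    using dyadic_length[of n j] by simp
  ultimately show ?thesis
    using assms(2) by (auto simp: dyadic_arc_iff[OF assms(1)] field_simps)
qed

lemma dyadic_path_ends [simp]:
  "pathstart (dyadic_path n j) = (dyadic_left n j, 0)"
  "pathfinish (dyadic_path n j) = (dyadic_right n j, 0)"
  by (auto simp: pathstart_def pathfinish_def dyadic_path_def dyadic_left_def dyadic_right_def)

lemma path_dyadic_path [simp]: "path (dyadic_path n j)"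
  unfolding path_def dyadic_path_def by (intro continuous_intros) auto

lemma path_image_dyadic_path: "(n, j) \<in> dyadic_index \<Longrightarrow> path_image (dyadic_path n j) \<subseteq> DD"
  using dyadic_path_arc by (force simp: path_image_def DD_eq)

lemma standard_path:
  assumes "p \<in> standard_paths" shows "path p" "path_image p \<subseteq> DD"
proof -
  obtain n j where "(n, j) \<in> dyadic_index" "p = dyadic_path n j \<or> p = reversepath (dyadic_path n j)"
    using assms by (auto simp: standard_paths_def)
  then show "path p" "path_image p \<subseteq> DD"
    using path_image_dyadic_path[of n j] by auto
qed

lemma standard_path_reverse: "p \<in> standard_paths \<Longrightarrow> reversepath p \<in> standard_paths"
  by (force simp: standard_paths_def)

lemma standard_path_left_half: "p \<in> standard_paths \<Longrightarrow> left_half \<circ> p \<in> standard_paths"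
  using left_half_index left_half_dyadic_path
  by (force simp: standard_paths_def path_compose_reversepath)

lemma standard_path_right_half: "p \<in> standard_paths \<Longrightarrow> right_half \<circ> p \<in> standard_paths"
  using right_half_index right_half_dyadic_path
  by (force simp: standard_paths_def path_compose_reversepath)

lemma finite_concatenation_path:
  "p \<in> finite_concatenations \<Longrightarrow> path p \<and> path_image p \<subseteq> DD"
  by (induction rule: finite_concatenations.induct) (auto simp: standard_path path_image_join)

section \<open>Paths homotopic to concatenations of standard paths\<close>

text \<open>
  These paths represent the elements of \<^const>\<open>D_subgroup\<close> when they are loops; unlike literal
  concatenations of standard paths they are closed under homotopy, reassociation and reversal.
\<close>

definition standardizable :: "(real \<Rightarrow> real \<times> real) \<Rightarrow> bool" where
  "standardizable p \<longleftrightarrow> (\<exists>q\<in>finite_concatenations. homotopic_paths DD p q)"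

lemma standardizableD: "standardizable p \<Longrightarrow> path p" "standardizable p \<Longrightarrow> path_image p \<subseteq> DD"
  unfolding standardizable_def by (auto dest: homotopic_paths_imp_path homotopic_paths_imp_subset)

lemma standardizable_homotopic:
  "\<lbrakk>homotopic_paths DD p q; standardizable q\<rbrakk> \<Longrightarrow> standardizable p"
  unfolding standardizable_def by (blast intro: homotopic_paths_trans)

lemma standardizable_standard: "p \<in> standard_paths \<Longrightarrow> standardizable p"
  unfolding standardizable_def
  by (rule bexI[of _ p]) (auto simp: standard_path intro: finite_concatenations.single)

lemma standardizable_join_finite:
  assumes "p \<in> finite_concatenations" "standardizable q" "pathfinish p = pathstart q"
  shows "standardizable (p +++ q)"
  using assms
proof (induction rule: finite_concatenations.induct)
  case (single p)
  then obtain r where r: "r \<in> finite_concatenations" "homotopic_paths DD q r"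
    by (auto simp: standardizable_def)
  have "pathfinish p = pathstart r"
    using single homotopic_paths_imp_pathstart[OF r(2)] by simp
  then have "p +++ r \<in> finite_concatenations"
    using single r by (intro finite_concatenations.join)
  moreover have "homotopic_paths DD (p +++ q) (p +++ r)"
    using single r standard_path[of p] by (intro homotopic_paths_join) auto
  ultimately show ?case by (auto simp: standardizable_def)
next
  case (join p p')
  then have s: "standardizable (p' +++ q)" by simp
  then obtain r where r: "r \<in> finite_concatenations" "homotopic_paths DD (p' +++ q) r"
    by (auto simp: standardizable_def)
  have "pathfinish p = pathstart r"
    using join homotopic_paths_imp_pathstart[OF r(2)] by simp
  then have "p +++ r \<in> finite_concatenations"
    using join r by (intro finite_concatenations.join)
  moreover have "homotopic_paths DD (p +++ (p' +++ q)) (p +++ r)"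
    using join r standard_path[of p] by (intro homotopic_paths_join) auto
  moreover have "homotopic_paths DD (p +++ (p' +++ q)) ((p +++ p') +++ q)"
    using join standard_path[of p] finite_concatenation_path[of p'] standardizableD[of q]
    by (intro homotopic_paths_assoc) auto
  ultimately show ?case unfolding standardizable_def
    by (meson homotopic_paths_sym homotopic_paths_trans)
qed

lemma standardizable_join:
  assumes "standardizable p" "standardizable q" "pathfinish p = pathstart q"
  shows "standardizable (p +++ q)"
proof -
  obtain p' where p': "p' \<in> finite_concatenations" "homotopic_paths DD p p'"
    using assms(1) by (auto simp: standardizable_def)
  have "standardizable (p' +++ q)"
    using p' assms homotopic_paths_imp_pathfinish[OF p'(2)]
    by (intro standardizable_join_finite) auto
  moreover have "homotopic_paths DD (p +++ q) (p' +++ q)"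
    using p' assms standardizableD[of q] by (intro homotopic_paths_join) auto
  ultimately show ?thesis by (rule standardizable_homotopic[rotated])
qed

lemma standardizable_reverse: assumes "standardizable p" shows "standardizable (reversepath p)"
proof -
  have *: "standardizable (reversepath q)" if "q \<in> finite_concatenations" for q
    using that
  proof (induction rule: finite_concatenations.induct)
    case (single p) then show ?case by (intro standardizable_standard standard_path_reverse)
  next
    case (join p q)
    then show ?case
      by (simp add: reversepath_joinpaths standardizable_join standardizable_standard standard_path_reverse)
  qed
  obtain q where "q \<in> finite_concatenations" "homotopic_paths DD p q"
    using assms by (auto simp: standardizable_def)
  then show ?thesis
    using * standardizable_homotopic homotopic_paths_reversepath_D by blast
qed

lemma standardizable_compose:
  assumes "standardizable p" and f: "continuous_on UNIV f" "f ` DD \<subseteq> DD"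
    and std: "\<And>q. q \<in> standard_paths \<Longrightarrow> f \<circ> q \<in> standard_paths"
  shows "standardizable (f \<circ> p)"
proof -
  have *: "f \<circ> q \<in> finite_concatenations" if "q \<in> finite_concatenations" for q
    using that
  proof (induction rule: finite_concatenations.induct)
    case (single p) then show ?case by (intro finite_concatenations.single std)
  next
    case (join p q)
    then show ?case unfolding path_compose_join
      by (intro finite_concatenations.join std join) (simp_all add: pathfinish_compose pathstart_compose join)
  qed
  obtain q where q: "q \<in> finite_concatenations" "homotopic_paths DD p q"
    using assms by (auto simp: standardizable_def)
  have "homotopic_paths DD (f \<circ> p) (f \<circ> q)"
    using f by (intro homotopic_paths_continuous_image[OF q(2)])
      (auto intro: continuous_on_subset)
  then show ?thesis using *[OF q(1)] by (auto simp: standardizable_def)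
qed

lemma standardizable_left_half: "standardizable p \<Longrightarrow> standardizable (left_half \<circ> p)"
  by (rule standardizable_compose)
     (auto intro!: continuous_intros left_half_DD standard_path_left_half simp del: o_apply)

lemma standardizable_right_half: "standardizable p \<Longrightarrow> standardizable (right_half \<circ> p)"
  by (rule standardizable_compose)
     (auto intro!: continuous_intros right_half_DD standard_path_right_half simp del: o_apply)

lemma top_index: "(1, 1) \<in> dyadic_index" "(Suc 0, Suc 0) \<in> dyadic_index" by (auto simp: dyadic_index_def)

lemma standardizable_top: "standardizable (dyadic_path 1 1)"
  using top_index by (intro standardizable_standard) (auto simp: standard_paths_def)

lemma top_ends: "dyadic_left (Suc 0) (Suc 0) = 0" "dyadic_right (Suc 0) (Suc 0) = 1"
  by (auto simp: dyadic_left_def dyadic_right_def)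

lemma standardizable_const: "standardizable (\<lambda>t. d0)"
proof (rule standardizable_homotopic)
  let ?l = "dyadic_path 1 1"
  show "standardizable (?l +++ reversepath ?l)"
    using standardizable_top by (intro standardizable_join standardizable_reverse) auto
  have "homotopic_paths DD (?l +++ reversepath ?l) (linepath (pathstart ?l) (pathstart ?l))"
    by (intro homotopic_paths_rinv) (use top_index path_image_dyadic_path in auto)
  moreover have "linepath (pathstart ?l) (pathstart ?l) = (\<lambda>t. d0)"
    by (simp add: d0_def top_ends linepath_def fun_eq_iff)
  ultimately show "homotopic_paths DD (\<lambda>t. d0) (?l +++ reversepath ?l)"
    by (simp add: homotopic_paths_sym)
qed

lemma standardizable_D_subgroup:
  assumes "standardizable p" "pathstart p = d0" "pathfinish p = d0"
  shows "path_class DD p \<in> D_subgroup"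
proof -
  obtain q where q: "q \<in> finite_concatenations" "homotopic_paths DD p q"
    using assms by (auto simp: standardizable_def)
  have "q \<in> loops_at DD d0"
    using q assms homotopic_paths_imp_pathstart[OF q(2)] homotopic_paths_imp_pathfinish[OF q(2)]
      finite_concatenation_path[OF q(1)] by (simp add: loops_at_def)
  moreover have "path_class DD p = path_class DD q"
    using q(2) unfolding path_class_def by (auto intro: homotopic_paths_trans homotopic_paths_sym)
  ultimately show ?thesis unfolding D_subgroup_def using q(1) by auto
qed

section \<open>The ramified path and the Cantor function\<close>

lemma cantor_join_homotopic:
  assumes P: "path P" "pathstart P = (0, 0)" "pathfinish P = (1, 0)"
    and M: "path M" "pathstart M = (1/2, 0)" "pathfinish M = (1/2, 0)"
    and S: "path_image (left_half \<circ> P) \<subseteq> S" "path_image M \<subseteq> S" "path_image (right_half \<circ> P) \<subseteq> S"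
  shows "homotopic_paths S ((left_half \<circ> P) +++ (M +++ (right_half \<circ> P))) (cantor_join M P)"
proof -
  let ?f = "\<lambda>t::real. if t \<le> 1/3 then 3 * t / 2 else (3 * t + 1) / 4"
  have lr: "path (left_half \<circ> P)" "path (right_half \<circ> P)"
    using P(1) by (auto intro!: path_continuous_image continuous_intros)
  have ends: "pathfinish (left_half \<circ> P) = pathstart M" "pathstart (right_half \<circ> P) = pathfinish M"
    using P M by (auto simp: pathfinish_compose pathstart_compose left_half_def right_half_def)
  show ?thesis
  proof (rule homotopic_paths_reparametrize[where f = ?f])
    show "continuous_on {0..1} ?f"
      by (intro continuous_on_cases_le[where h = "\<lambda>t. t"] continuous_intros) auto
    show "cantor_join M P t = ((left_half \<circ> P) +++ (M +++ (right_half \<circ> P))) (?f t)"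
      if "t \<in> {0..1}" for t
    proof -
      consider "t \<le> 1/3" | "1/3 < t" "t \<le> 2/3" | "2/3 < t" by linarith
      then show ?thesis by cases (auto simp: cantor_join_def joinpaths_def field_simps
            intro!: arg_cong[where f = M] arg_cong[where f = "\<lambda>x. right_half (P x)"])
    qed
  qed (use lr ends M S in \<open>auto simp: path_image_join\<close>)
qed

lemma cantor_join_fixpoint:
  assumes fix_eq: "\<And>t. t \<in> {0..1} \<Longrightarrow> T t = cantor_join M T t"
    and T: "pathstart T = (0, 0)" "pathfinish T = (1, 0)"
    and M: "pathstart M = (1/2, 0)" "pathfinish M = (1/2, 0)"
    and t: "t \<in> {0..1}"
  shows "T (t / 3) = left_half (T t)" "T ((t + 1) / 3) = M t" "T ((t + 2) / 3) = right_half (T t)"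
proof -
  have ends: "T 0 = (0, 0)" "T 1 = (1, 0)" "M 0 = (1/2, 0)" "M 1 = (1/2, 0)"
    using T M by (auto simp: pathstart_def pathfinish_def)
  show "T (t / 3) = left_half (T t)"
    using t by (subst fix_eq) (auto simp: cantor_join_def)
  show "T ((t + 1) / 3) = M t"
    using t ends by (subst fix_eq)
      (auto simp: cantor_join_def left_half_def field_simps intro!: arg_cong[where f = M])
  show "T ((t + 2) / 3) = right_half (T t)"
    using t ends by (subst fix_eq)
      (auto simp: cantor_join_def right_half_def field_simps
        intro!: arg_cong[where f = "\<lambda>x. fst (T x)"] arg_cong[where f = "\<lambda>x. snd (T x)"])
qed

text \<open>
  This is the homotopy between an arc \<open>l\<close> over a dyadic interval and the refinement used below, with
  \<open>a\<close> and \<open>b\<close> the arcs over the two halves of the interval.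
\<close>

lemma homotopic_cancel_ends:
  fixes S :: "'a::real_normed_vector set"
  assumes "path a" "path l" "path b" "path_image a \<subseteq> S" "path_image l \<subseteq> S" "path_image b \<subseteq> S"
    and "pathstart a = pathstart l" "pathfinish b = pathfinish l" "pathfinish a = pathstart b"
  shows "homotopic_paths S (a +++ ((reversepath a +++ (l +++ reversepath b)) +++ b)) l"
proof -
  define s where "s = l +++ reversepath b"
  have s: "path s" "path_image s \<subseteq> S" "pathstart s = pathstart l" "pathfinish s = pathstart b"
    using assms by (auto simp: s_def path_image_join)
  have "homotopic_paths S (a +++ ((reversepath a +++ s) +++ b)) ((a +++ (reversepath a +++ s)) +++ b)"
    by (rule homotopic_paths_assoc) (use assms s in \<open>auto simp: path_image_join\<close>)
  also have "homotopic_paths S \<dots> (((a +++ reversepath a) +++ s) +++ b)"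
    by (intro homotopic_paths_join homotopic_paths_assoc) (use assms s in \<open>auto simp: path_image_join\<close>)
  also have "homotopic_paths S \<dots> ((linepath (pathstart a) (pathstart a) +++ s) +++ b)"
    by (intro homotopic_paths_join homotopic_paths_rinv) (use assms s in \<open>auto simp: path_image_join\<close>)
  also have "homotopic_paths S \<dots> (s +++ b)"
    by (intro homotopic_paths_join homotopic_paths_lid') (use assms s in \<open>auto simp: path_image_join\<close>)
  also have "homotopic_paths S \<dots> (l +++ (reversepath b +++ b))"
    unfolding s_def
    by (rule homotopic_paths_sym, rule homotopic_paths_assoc)
      (use assms in \<open>auto simp: path_image_join\<close>)
  also have "homotopic_paths S \<dots> (l +++ linepath (pathfinish b) (pathfinish b))"
    by (intro homotopic_paths_join homotopic_paths_linv) (use assms s in \<open>auto simp: path_image_join\<close>)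
  also have "homotopic_paths S \<dots> l"
    by (intro homotopic_paths_rid') (use assms in auto)
  finally show ?thesis by (simp add: s_def)
qed

abbreviation big_arc :: "real \<Rightarrow> real \<times> real" where
  "big_arc \<equiv> dyadic_path 1 1"

text \<open>
  The loop at (1/2,0) around the region below the big semicircle and above the two semicircles of the
  next generation. It starts backwards along the left small arc, so that it cancels against a
  preceding \<open>left_half \<circ> big_arc\<close> and a following \<open>right_half \<circ> big_arc\<close>, and it is a
  concatenation of standard paths.
\<close>

definition boundary_loop :: "real \<Rightarrow> real \<times> real" where
  "boundary_loop = reversepath (left_half \<circ> big_arc) +++ (big_arc +++ reversepath (right_half \<circ> big_arc))"

lemma half_big_arc:
  "path (left_half \<circ> big_arc)" "path (right_half \<circ> big_arc)"
  "path_image (left_half \<circ> big_arc) \<subseteq> DD" "path_image (right_half \<circ> big_arc) \<subseteq> DD"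
  "pathstart (left_half \<circ> big_arc) = (0, 0)" "pathfinish (left_half \<circ> big_arc) = (1/2, 0)"
  "pathstart (right_half \<circ> big_arc) = (1/2, 0)" "pathfinish (right_half \<circ> big_arc) = (1, 0)"
proof -
  show "path (left_half \<circ> big_arc)" "path (right_half \<circ> big_arc)"
    "path_image (left_half \<circ> big_arc) \<subseteq> DD" "path_image (right_half \<circ> big_arc) \<subseteq> DD"
    using standardizableD standardizable_left_half[OF standardizable_top]
      standardizable_right_half[OF standardizable_top] by auto
qed (auto simp: pathfinish_compose pathstart_compose top_ends left_half_def right_half_def)

lemma big_arc_ends: "pathstart big_arc = (0, 0)" "pathfinish big_arc = (1, 0)"
  by (auto simp: top_ends)

lemma big_arc_DD: "path_image big_arc \<subseteq> DD"
  using path_image_dyadic_path[OF top_index(1)] .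

lemma boundary_loop:
  "path boundary_loop" "path_image boundary_loop \<subseteq> DD"
  "pathstart boundary_loop = (1/2, 0)" "pathfinish boundary_loop = (1/2, 0)"
  using half_big_arc big_arc_DD big_arc_ends by (auto simp: boundary_loop_def path_image_join)

lemma standardizable_boundary_loop: "standardizable boundary_loop"
  unfolding boundary_loop_def
  by (intro standardizable_join standardizable_reverse standardizable_left_half
      standardizable_right_half standardizable_top) (use half_big_arc big_arc_ends in auto)

lemma ex_ramified_path:
  "\<exists>T. homotopic_paths DD big_arc T \<and> (\<forall>t\<in>{0..1}. T t = cantor_join boundary_loop T t)"
proof -
  have "homotopic_paths DD ((left_half \<circ> big_arc) +++ (boundary_loop +++ (right_half \<circ> big_arc))) big_arc"
    unfolding boundary_loop_def
    by (rule homotopic_cancel_ends) (use half_big_arc big_arc_DD big_arc_ends in auto)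
  moreover have "homotopic_paths DD ((left_half \<circ> big_arc) +++ (boundary_loop +++ (right_half \<circ> big_arc)))
      (cantor_join boundary_loop big_arc)"
    by (rule cantor_join_homotopic) (use half_big_arc big_arc_DD big_arc_ends boundary_loop in auto)
  ultimately have "homotopic_paths DD big_arc (cantor_join boundary_loop big_arc)"
    by (meson homotopic_paths_sym homotopic_paths_trans)
  then show ?thesis
    by (rule infinite_refinement[OF closed_DD bounded_DD left_half_DD right_half_DD
          boundary_loop big_arc_ends]) blast
qed

text \<open>
  A path that is parametrized by the base and makes, over each gap of the Cantor set, a detour around
  one triangle of three dyadic arcs. Homotopically all these detours together amount to the big arc:
  the two smaller arcs of each triangle are cancelled by the larger arcs in the detours of the next
  stage.
\<close>

definition ramified_path :: "real \<Rightarrow> real \<times> real" where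
  "ramified_path = (SOME T. homotopic_paths DD big_arc T \<and> (\<forall>t\<in>{0..1}. T t = cantor_join boundary_loop T t))"

lemma ramified_path:
  "homotopic_paths DD big_arc ramified_path"
  "t \<in> {0..1} \<Longrightarrow> ramified_path t = cantor_join boundary_loop ramified_path t"
  using someI_ex[OF ex_ramified_path] unfolding ramified_path_def by auto

lemma ramified_path_path:
  "path ramified_path" "path_image ramified_path \<subseteq> DD"
  "pathstart ramified_path = (0, 0)" "pathfinish ramified_path = (1, 0)"
  using homotopic_paths_imp_path[OF ramified_path(1)] homotopic_paths_imp_subset[OF ramified_path(1)]
    homotopic_paths_imp_pathstart[OF ramified_path(1)]
    homotopic_paths_imp_pathfinish[OF ramified_path(1)] big_arc_ends by auto

lemma ramified_path_rec:
  assumes "t \<in> {0..1}"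
  shows "ramified_path (t / 3) = left_half (ramified_path t)"
    "ramified_path ((t + 1) / 3) = boundary_loop t"
    "ramified_path ((t + 2) / 3) = right_half (ramified_path t)"
  by (rule cantor_join_fixpoint[OF _ ramified_path_path(3,4) boundary_loop(3,4) assms],
      erule ramified_path(2))+

lemma ex_staircase_path:
  "\<exists>T. homotopic_paths ({0..1} \<times> {0}) lambda_inf T \<and> (\<forall>t\<in>{0..1}. T t = cantor_join (\<lambda>_. (1/2, 0)) T t)"
proof -
  let ?f = "\<lambda>t::real. if t \<le> 1/3 then 3 * t / 2 else if t \<le> 2/3 then 1/2 else (3 * t - 1) / 2"
  have "homotopic_paths ({0..1} \<times> {0}) lambda_inf (cantor_join (\<lambda>_. (1/2, 0)) lambda_inf)"
  proof (rule homotopic_paths_reparametrize[where f = ?f])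
    show "continuous_on {0..1} ?f"
      by (intro continuous_on_cases_le[where h = "\<lambda>t. t"] continuous_intros) auto
    show "path lambda_inf" unfolding path_def lambda_inf_def by (intro continuous_intros)
  qed (auto simp: path_image_def lambda_inf_def cantor_join_def left_half_def right_half_def field_simps)
  from _ _ _ _ _ _ _ _ _ _ this show ?thesis
  proof (rule infinite_refinement)
    show "bounded ({0..1::real} \<times> {0::real})" by (intro bounded_Times) auto
    show "path (\<lambda>_::real. (1/2::real, 0::real))" by (auto simp: path_def)
    show "closed ({0..1::real} \<times> {0::real})" by (intro closed_Times) auto
  qed (auto simp: pathstart_def pathfinish_def lambda_inf_def left_half_def right_half_def path_image_def)
qed

text \<open>
  The Cantor function, regarded as a path in the base. It is obtained from the same refinement lemma
  as the ramified path, so that both paths obey recursions of the same shape.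
\<close>

definition staircase_path :: "real \<Rightarrow> real \<times> real" where
  "staircase_path = (SOME T. homotopic_paths ({0..1} \<times> {0}) lambda_inf T \<and>
     (\<forall>t\<in>{0..1}. T t = cantor_join (\<lambda>_. (1/2, 0)) T t))"

lemma staircase_path:
  "homotopic_paths ({0..1} \<times> {0}) lambda_inf staircase_path"
  "t \<in> {0..1} \<Longrightarrow> staircase_path t = cantor_join (\<lambda>_. (1/2, 0)) staircase_path t"
  using someI_ex[OF ex_staircase_path] unfolding staircase_path_def by auto

lemma staircase_path_DD: "homotopic_paths DD lambda_inf staircase_path"
  by (rule homotopic_paths_subset[OF staircase_path(1)]) (auto simp: DD_def)

lemma staircase_path_path:
  "path staircase_path" "path_image staircase_path \<subseteq> DD"
  "pathstart staircase_path = (0, 0)" "pathfinish staircase_path = (1, 0)"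
  using homotopic_paths_imp_path[OF staircase_path_DD] homotopic_paths_imp_subset[OF staircase_path_DD]
    homotopic_paths_imp_pathstart[OF staircase_path_DD]
    homotopic_paths_imp_pathfinish[OF staircase_path_DD]
  by (auto simp: pathstart_def pathfinish_def lambda_inf_def)

lemma const_ends: "pathstart (\<lambda>_. x) = x" "pathfinish (\<lambda>_. x) = x"
  by (auto simp: pathstart_def pathfinish_def)

lemma staircase_path_rec:
  assumes "t \<in> {0..1}"
  shows "staircase_path (t / 3) = left_half (staircase_path t)"
    "staircase_path ((t + 1) / 3) = (1/2, 0)"
    "staircase_path ((t + 2) / 3) = right_half (staircase_path t)"
  by (rule cantor_join_fixpoint[OF _ staircase_path_path(3,4) const_ends assms],
      erule staircase_path(2))+

lemma cantor_stage_subset: "cantor_stage n \<subseteq> {0..1}"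
  by (induction n) force+

text \<open>
  The two recursions differ only over the middle third, which a point of the Cantor set avoids at
  every stage; over the outer thirds each step halves the distance between the two paths.
\<close>

lemma ramified_eq_staircase:
  assumes "t \<in> cantor_set"
  shows "ramified_path t = staircase_path t"
proof -
  obtain C where C: "\<And>x y. x \<in> DD \<Longrightarrow> y \<in> DD \<Longrightarrow> norm (x - y) \<le> C"
    using bounded_DD by (metis bounded_two_points dist_norm)
  have bound: "norm (ramified_path t - staircase_path t) \<le> C * (1/2) ^ n" if "t \<in> cantor_stage n" for n t
    using that
  proof (induction n arbitrary: t)
    case 0
    then have "ramified_path t \<in> DD" "staircase_path t \<in> DD"
      using ramified_path_path(2) staircase_path_path(2) by (auto simp: path_image_def)
    then show ?case using C by simp
  next
    case (Suc n)
    then obtain x where x: "x \<in> cantor_stage n" "t = x / 3 \<or> t = (x + 2) / 3" by auto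
    then have x01: "x \<in> {0..1}" using cantor_stage_subset by blast
    from x(2) have "ramified_path t - staircase_path t = (1/2) *\<^sub>R (ramified_path x - staircase_path x)"
      by (elim disjE) (simp_all only: ramified_path_rec[OF x01] staircase_path_rec[OF x01] left_half_diff right_half_diff)
    then show ?case using Suc.IH[OF x(1)] by simp
  qed
  have lim: "(\<lambda>n. C * (1/2) ^ n) \<longlonglongrightarrow> C * 0"
    by (intro tendsto_intros LIMSEQ_power_zero) auto
  have "norm (ramified_path t - staircase_path t) \<le> C * (1/2) ^ n" for n
    by (rule bound) (use assms in \<open>auto simp: cantor_set_def\<close>)
  then have "norm (ramified_path t - staircase_path t) \<le> C * 0"
    by (intro LIMSEQ_le_const[OF lim]) blast
  then show ?thesis by simp
qed

section \<open>The gaps of the Cantor set\<close>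

text \<open>
  The recursive description of the components of the complement of the Cantor set. It supplies the
  induction principle that matches the self-similarity of the paths over the gaps.
\<close>

inductive_set middle_third_gaps :: "(real \<times> real) set" where
  middle: "(1/3, 2/3) \<in> middle_third_gaps"
| left: "(a, b) \<in> middle_third_gaps \<Longrightarrow> (a / 3, b / 3) \<in> middle_third_gaps"
| right: "(a, b) \<in> middle_third_gaps \<Longrightarrow> ((a + 2) / 3, (b + 2) / 3) \<in> middle_third_gaps"

lemma middle_third_gaps_bounds:
  "(a, b) \<in> middle_third_gaps \<Longrightarrow> 0 < a \<and> a < b \<and> b < 1"
  by (induction rule: middle_third_gaps.induct) auto

lemma cantor_set_subset: "cantor_set \<subseteq> {0..1}"
  unfolding cantor_set_def using cantor_stage_subset[of 0] by blast

lemma cantor_set_ends: "0 \<in> cantor_set" "1 \<in> cantor_set"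
proof -
  have "0 \<in> cantor_stage n \<and> 1 \<in> cantor_stage n" for n by (induction n) force+
  then show "0 \<in> cantor_set" "1 \<in> cantor_set" by (auto simp: cantor_set_def)
qed

lemma cantor_set_thirds:
  assumes x: "x \<in> cantor_set" shows "x / 3 \<in> cantor_set" "(x + 2) / 3 \<in> cantor_set"
proof -
  have "x \<in> {0..1}" "x \<in> cantor_stage n" for n using x cantor_set_subset by (auto simp: cantor_set_def)
  then have "x / 3 \<in> cantor_stage n \<and> (x + 2) / 3 \<in> cantor_stage n" for n by (cases n) auto
  then show "x / 3 \<in> cantor_set" "(x + 2) / 3 \<in> cantor_set" by (auto simp: cantor_set_def)
qed

lemma cantor_set_cases:
  assumes "x \<in> cantor_set"
  shows "x < 2/3 \<Longrightarrow> 3 * x \<in> cantor_set" "1/3 < x \<Longrightarrow> 3 * x - 2 \<in> cantor_set"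
proof -
  have *: "x < 2/3 \<longrightarrow> 3 * x \<in> cantor_stage n" "1/3 < x \<longrightarrow> 3 * x - 2 \<in> cantor_stage n" for n
  proof -
    have "x \<in> cantor_stage (Suc n)" using assms unfolding cantor_set_def by blast
    then obtain y where y: "y \<in> cantor_stage n" "x = y / 3 \<or> x = (y + 2) / 3" by auto
    then have "y \<in> {0..1}" using cantor_stage_subset by blast
    then show "x < 2/3 \<longrightarrow> 3 * x \<in> cantor_stage n" "1/3 < x \<longrightarrow> 3 * x - 2 \<in> cantor_stage n"
      using y by (auto simp: mult.commute)
  qed
  then show "x < 2/3 \<Longrightarrow> 3 * x \<in> cantor_set" "1/3 < x \<Longrightarrow> 3 * x - 2 \<in> cantor_set"
    by (auto simp: cantor_set_def)
qed

lemma middle_third_gap_cantor: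
  "(a, b) \<in> middle_third_gaps \<Longrightarrow> a \<in> cantor_set \<and> b \<in> cantor_set \<and> {a<..<b} \<inter> cantor_set = {}"
proof (induction rule: middle_third_gaps.induct)
  case middle
  have "x \<notin> cantor_set" if "1/3 < x" "x < 2/3" for x
    using cantor_set_cases[of x] cantor_set_subset that by force
  then show ?case
    using cantor_set_thirds(1)[OF cantor_set_ends(2)] cantor_set_thirds(2)[OF cantor_set_ends(1)] by auto
next
  case (left a b)
  have "x \<notin> cantor_set" if "a / 3 < x" "x < b / 3" for x
  proof
    assume "x \<in> cantor_set"
    then have "3 * x \<in> cantor_set"
      using that middle_third_gaps_bounds[OF left(1)] by (intro cantor_set_cases) auto
    moreover have "3 * x \<in> {a<..<b}" using that by auto
    ultimately show False using left.IH by blast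
  qed
  then show ?case using left.IH cantor_set_thirds(1) by auto
next
  case (right a b)
  have "x \<notin> cantor_set" if "(a + 2) / 3 < x" "x < (b + 2) / 3" for x
  proof
    assume "x \<in> cantor_set"
    then have "3 * x - 2 \<in> cantor_set"
      using that middle_third_gaps_bounds[OF right(1)] by (intro cantor_set_cases) auto
    moreover have "3 * x - 2 \<in> {a<..<b}" using that by auto
    ultimately show False using right.IH by blast
  qed
  then show ?case using right.IH cantor_set_thirds(2) by auto
qed

lemma middle_third_gap_exists:
  assumes "t \<in> {0..1}" "t \<notin> cantor_set"
  shows "\<exists>(a, b)\<in>middle_third_gaps. a < t \<and> t < b"
proof -
  have "\<exists>(a, b)\<in>middle_third_gaps. a < t \<and> t < b" if "t \<in> {0..1}" "t \<notin> cantor_stage n" for n t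
    using that
  proof (induction n arbitrary: t)
    case 0 then show ?case by simp
  next
    case (Suc n)
    consider "t \<le> 1/3" | "1/3 < t" "t < 2/3" | "2/3 \<le> t" by linarith
    then show ?case
    proof cases
      case 1
      then have "3 * t \<notin> cantor_stage n"
        using Suc.prems(2) by (auto dest!: imageI[of "3 * t" _ "\<lambda>x. x / 3"])
      then obtain a b where "(a, b) \<in> middle_third_gaps" "a < 3 * t" "3 * t < b"
        using Suc.IH[of "3 * t"] 1 Suc.prems(1) by auto
      then show ?thesis using middle_third_gaps.left by (intro bexI[of _ "(a / 3, b / 3)"]) auto
    next
      case 2
      then show ?thesis using middle_third_gaps.middle by blast
    next
      case 3
      then have "3 * t - 2 \<notin> cantor_stage n"
        using Suc.prems(2) by (auto dest!: imageI[of "3 * t - 2" _ "\<lambda>x. (x + 2) / 3"])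
      then obtain a b where "(a, b) \<in> middle_third_gaps" "a < 3 * t - 2" "3 * t - 2 < b"
        using Suc.IH[of "3 * t - 2"] 3 Suc.prems(1) by auto
      then show ?thesis using middle_third_gaps.right
        by (intro bexI[of _ "((a + 2) / 3, (b + 2) / 3)"]) auto
    qed
  qed
  then show ?thesis using assms by (auto simp: cantor_set_def)
qed

text \<open>
  A larger connected subset would contain an end point of the gap, but the end points lie in the
  Cantor set.
\<close>

lemma middle_third_gap_component:
  assumes G: "(a, b) \<in> middle_third_gaps"
  shows "{a<..<b} \<in> components ({0..1} - cantor_set)"
  unfolding in_components_maximal
proof (intro conjI allI impI)
  have ab: "0 < a" "a < b" "b < 1" using middle_third_gaps_bounds[OF G] by auto
  show "{a<..<b} \<noteq> {}" using ab by simp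
  show "{a<..<b} \<subseteq> {0..1} - cantor_set" using middle_third_gap_cantor[OF G] ab by auto
  show "connected {a<..<b}" by simp
  fix d assume d: "d \<noteq> {} \<and> {a<..<b} \<subseteq> d \<and> d \<subseteq> {0..1} - cantor_set \<and> connected d"
  have "(a + b) / 2 \<in> {a<..<b}" using ab by simp
  then have mid: "(a + b) / 2 \<in> d" using d by blast
  have "x \<in> {a<..<b}" if "x \<in> d" for x
  proof (rule ccontr)
    assume "x \<notin> {a<..<b}"
    then have "a \<in> {x..(a + b) / 2} \<or> b \<in> {(a + b) / 2..x}" using ab by auto
    then have "a \<in> d \<or> b \<in> d"
      using d mid that connected_contains_Icc[of d] by blast
    then show False using d middle_third_gap_cantor[OF G] by auto
  qed
  then show "d = {a<..<b}" using d by blast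
qed

lemma open_interval_eq: "{a<..<b} = {c<..<d} \<Longrightarrow> a < b \<Longrightarrow> (a, b) = (c, d)" for a b c d :: real
  by (metis greaterThanLessThan_eq_iff prod.inject order.strict_iff_not) 

lemma cantor_gaps_disjoint:
  assumes "(a, b) \<in> cantor_gaps" "(c, d) \<in> cantor_gaps" "t \<in> {a<..<b}" "t \<in> {c<..<d}"
  shows "a = c" "b = d"
proof -
  have "{a<..<b} = {c<..<d}"
  proof -
    have "{a<..<b} \<in> components ({0..1} - cantor_set)" "{c<..<d} \<in> components ({0..1} - cantor_set)"
      using assms(1,2) by (auto simp: cantor_gaps_def)
    then show ?thesis using assms(3,4) components_nonoverlap by (metis disjoint_iff)
  qed
  moreover have "a < b" using assms(1) by (simp add: cantor_gaps_def)
  ultimately have "(a, b) = (c, d)" by (rule open_interval_eq)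
  then show "a = c" "b = d" by simp_all
qed

lemma cantor_gaps_eq: "cantor_gaps = middle_third_gaps"
proof
  show sub: "middle_third_gaps \<subseteq> cantor_gaps"
    using middle_third_gap_component middle_third_gaps_bounds by (auto simp: cantor_gaps_def)
  show "cantor_gaps \<subseteq> middle_third_gaps"
  proof safe
    fix a b assume ab: "(a, b) \<in> cantor_gaps"
    define t where "t = (a + b) / 2"
    have t: "t \<in> {a<..<b}" using ab by (auto simp: cantor_gaps_def t_def)
    then have "t \<in> {0..1} - cantor_set"
      using ab in_components_subset unfolding cantor_gaps_def by blast
    then obtain c d where cd: "(c, d) \<in> middle_third_gaps" "t \<in> {c<..<d}"
      using middle_third_gap_exists[of t] by auto
    then show "(a, b) \<in> middle_third_gaps"
      using cantor_gaps_disjoint[OF ab _ t cd(2)] sub by auto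
  qed
qed

lemma cantor_gap_bounds: "(a, b) \<in> cantor_gaps \<Longrightarrow> 0 < a \<and> a < b \<and> b < 1"
  using middle_third_gaps_bounds by (simp add: cantor_gaps_eq)

text \<open>
  Height over t of the path that follows the semicircles over the gaps in E and runs along the base
  elsewhere. Allowing sets of gaps between the two extremes of no gap and all gaps gives the
  mixed paths to which dyadic arcs are sent below.
\<close>

definition gap_height :: "(real \<times> real) set \<Rightarrow> real \<Rightarrow> real" where
  "gap_height E t =
    (if \<exists>I\<in>E. fst I < t \<and> t < snd I
     then let (a, b) = (THE I. I \<in> E \<and> fst I < t \<and> t < snd I) in sqrt ((t - a) * (b - t))
     else 0)"

lemma gap_height_out: "(\<And>a b. (a, b) \<in> E \<Longrightarrow> \<not> (a < t \<and> t < b)) \<Longrightarrow> gap_height E t = 0"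
  unfolding gap_height_def by auto

lemma gap_height_interior:
  assumes "E \<subseteq> cantor_gaps" "(a, b) \<in> E" "a < t" "t < b"
  shows "gap_height E t = sqrt ((t - a) * (b - t))"
proof -
  have "I = (a, b)" if "I \<in> E \<and> fst I < t \<and> t < snd I" for I
    using cantor_gaps_disjoint[of "fst I" "snd I" a b t] assms that by (cases I) auto
  moreover have "(a, b) \<in> E \<and> fst (a, b) < t \<and> t < snd (a, b)" using assms by simp
  ultimately have "(THE I. I \<in> E \<and> fst I < t \<and> t < snd I) = (a, b)"
    by (rule the_equality[rotated])
  moreover have "\<exists>I\<in>E. fst I < t \<and> t < snd I" using assms by (intro bexI[of _ "(a, b)"]) auto
  ultimately show ?thesis unfolding gap_height_def by simp
qed

text \<open>
  Otherwise the two gaps would overlap without being equal.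
\<close>

lemma gap_ends_outside:
  assumes "(a, b) \<in> cantor_gaps" "(c, d) \<in> cantor_gaps"
  shows "\<not> (c < a \<and> a < d)" "\<not> (c < b \<and> b < d)"
proof -
  have "False" if "c < x" "x < d" "x = a \<or> x = b" for x
  proof -
    have "\<exists>t. t \<in> {a<..<b} \<and> t \<in> {c<..<d}"
      using cantor_gap_bounds[OF assms(1)] that
      by (intro exI[of _ "if x = a then (a + min b d) / 2 else (b + max a c) / 2"]) (auto simp: min_def max_def)
    then show False using cantor_gaps_disjoint[OF assms] that by auto
  qed
  then show "\<not> (c < a \<and> a < d)" "\<not> (c < b \<and> b < d)" by auto
qed

lemma gap_height_in:
  assumes "E \<subseteq> cantor_gaps" "(a, b) \<in> E" "a \<le> t" "t \<le> b"
  shows "gap_height E t = sqrt ((t - a) * (b - t))"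
proof (cases "a < t \<and> t < b")
  case True
  then show ?thesis using gap_height_interior assms by blast
next
  case False
  then have "t = a \<or> t = b" using assms by auto
  moreover from this have "gap_height E t = 0"
    using gap_ends_outside[of a b] assms by (intro gap_height_out) blast
  ultimately show ?thesis by auto
qed

lemma gap_height_square_le:
  assumes E: "E \<subseteq> cantor_gaps" and st: "\<And>a b. (a, b) \<in> E \<Longrightarrow> a < s \<Longrightarrow> s < b \<Longrightarrow> e \<ge> s - a \<or> e \<ge> b - s" and "0 \<le> e"
  shows "(gap_height E s)\<^sup>2 \<le> e"
proof (cases "\<exists>(a, b)\<in>E. a < s \<and> s < b")
  case True
  then obtain a b where ab: "(a, b) \<in> E" "a < s" "s < b" by auto
  have bd: "0 < a" "b < 1" using cantor_gap_bounds E ab by blast+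
  have "(gap_height E s)\<^sup>2 = (s - a) * (b - s)" using gap_height_interior[OF E ab] ab by simp
  moreover have "(s - a) * (b - s) \<le> 1 * (b - s)" "(s - a) * (b - s) \<le> (s - a) * 1"
    using ab bd by (intro mult_right_mono mult_left_mono; simp)+
  ultimately show ?thesis using st[OF ab] by auto
next
  case False
  then have "gap_height E s = 0" by (intro gap_height_out) auto
  then show ?thesis using assms by simp
qed

lemma gap_height_nonneg: "E \<subseteq> cantor_gaps \<Longrightarrow> 0 \<le> gap_height E t"
  using gap_height_interior[of E _ _ t] gap_height_out[of E t]
  by (metis diff_ge_0_iff_ge less_eq_real_def mult_nonneg_nonneg order_refl real_sqrt_ge_zero)

text \<open>
  Over a single gap (a,b) the squared height is \<open>(t - a) * (b - t)\<close>, with slope at most \<open>b - a \<le> 1\<close>.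
  If s and t do not lie over a common gap of E, then each of them has height 0 or lies over a gap with
  an end point between s and t, and the squared height is at most the distance to that end point.
\<close>

lemma gap_height_square_Lipschitz:
  assumes E: "E \<subseteq> cantor_gaps" and "s \<le> t"
  shows "\<bar>(gap_height E s)\<^sup>2 - (gap_height E t)\<^sup>2\<bar> \<le> t - s"
proof (cases "\<exists>(a, b)\<in>E. a \<le> s \<and> t \<le> b")
  case True
  then obtain a b where ab: "(a, b) \<in> E" "a \<le> s" "t \<le> b" by auto
  have bd: "0 < a" "b < 1" using cantor_gap_bounds E ab by blast+
  have "(gap_height E s)\<^sup>2 = (s - a) * (b - s)" "(gap_height E t)\<^sup>2 = (t - a) * (b - t)"
    using gap_height_in[OF E ab(1)] ab assms(2) by auto
  then have "(gap_height E s)\<^sup>2 - (gap_height E t)\<^sup>2 = (t - s) * (s + t - a - b)"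
    by (simp add: algebra_simps)
  then have "\<bar>(gap_height E s)\<^sup>2 - (gap_height E t)\<^sup>2\<bar> = (t - s) * \<bar>s + t - a - b\<bar>"
    using assms(2) by (simp add: abs_mult)
  also have "\<dots> \<le> (t - s) * 1" using ab bd assms(2) by (intro mult_left_mono) auto
  finally show ?thesis by simp
next
  case False
  have "(gap_height E s)\<^sup>2 \<le> t - s"
    by (rule gap_height_square_le[OF E]) (use False assms(2) in force)+
  moreover have "(gap_height E t)\<^sup>2 \<le> t - s"
    by (rule gap_height_square_le[OF E]) (use False assms(2) in force)+
  ultimately show ?thesis using zero_le_power2[of "gap_height E s"] zero_le_power2[of "gap_height E t"]
    by linarith
qed

lemma continuous_on_gap_height:
  assumes E: "E \<subseteq> cantor_gaps" shows "continuous_on A (gap_height E)"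
proof -
  have "\<bar>(gap_height E s)\<^sup>2 - (gap_height E t)\<^sup>2\<bar> \<le> \<bar>s - t\<bar>" for s t
    using gap_height_square_Lipschitz[OF E, of s t] gap_height_square_Lipschitz[OF E, of t s]
    by (cases "s \<le> t") auto
  then have "continuous_on A (\<lambda>t. (gap_height E t)\<^sup>2)"
    unfolding continuous_on_iff dist_real_def by (meson le_less_trans)
  then have "continuous_on A (\<lambda>t. sqrt ((gap_height E t)\<^sup>2))" by (rule continuous_on_real_sqrt)
  then show ?thesis using gap_height_nonneg[OF E] by simp
qed

definition gap_path :: "(real \<times> real) set \<Rightarrow> real \<Rightarrow> real \<times> real" where
  "gap_path E t = (t, gap_height E t)"

lemma path_gap_path: "E \<subseteq> cantor_gaps \<Longrightarrow> path (gap_path E)"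
  unfolding path_def gap_path_def by (intro continuous_intros continuous_on_gap_height)

lemma WW_base: "x \<in> {0..1} \<Longrightarrow> (x, 0) \<in> WW" by (auto simp: WW_def)

lemma gap_path_WW: assumes E: "E \<subseteq> cantor_gaps" and t: "t \<in> {0..1}" shows "gap_path E t \<in> WW"
proof (cases "\<exists>(a, b)\<in>E. a < t \<and> t < b")
  case True
  then obtain a b where ab: "(a, b) \<in> E" "a < t" "t < b" by auto
  then have "gap_path E t \<in> upper_semicircle ((a + b) / 2) ((b - a) / 2)"
    using gap_height_interior[OF E ab] by (simp add: gap_path_def upper_semicircle_iff)
  then show ?thesis using ab E by (auto simp: WW_def)
next
  case False
  then have "gap_height E t = 0" by (intro gap_height_out) auto
  then show ?thesis using t by (auto simp: gap_path_def WW_base)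
qed

lemma path_image_gap_path: "E \<subseteq> cantor_gaps \<Longrightarrow> path_image (gap_path E) \<subseteq> WW"
  using gap_path_WW by (auto simp: path_image_def)

text \<open>
  Two closed sets cover \<^const>\<open>WW\<close>: the base, and one arc that contains all the semicircles. Maps
  out of \<^const>\<open>WW\<close> can thus be pasted from two pieces.
\<close>

lemma WW_eq: "WW = {0..1} \<times> {0} \<union> gap_path cantor_gaps ` {0..1}"
proof -
  have "z \<in> gap_path cantor_gaps ` {0..1}"
    if "(a, b) \<in> cantor_gaps" "z \<in> upper_semicircle ((a + b) / 2) ((b - a) / 2)" for a b z
  proof -
    have "a \<le> fst z" "fst z \<le> b" "snd z = sqrt ((fst z - a) * (b - fst z))" "0 < a" "b < 1"
      using upper_semicircle_bounds[of "fst z" "snd z" a b] cantor_gap_bounds that by auto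
    then show ?thesis
      using gap_height_in[OF order_refl that(1), of "fst z"] 
      by (intro image_eqI[of _ _ "fst z"]) (auto simp: gap_path_def prod_eq_iff)
  qed
  then have "WW \<subseteq> {0..1} \<times> {0} \<union> gap_path cantor_gaps ` {0..1}" unfolding WW_def by blast
  moreover have "{0..1} \<times> {0} \<union> gap_path cantor_gaps ` {0..1} \<subseteq> WW"
    using gap_path_WW WW_base by auto
  ultimately show ?thesis by blast
qed

lemma gap_height_cantor: "E \<subseteq> cantor_gaps \<Longrightarrow> t \<in> cantor_set \<Longrightarrow> gap_height E t = 0"
  using middle_third_gap_cantor unfolding cantor_gaps_eq by (intro gap_height_out) fastforce

lemma gap_height_zero_iff:
  assumes "t \<in> {0..1}" shows "gap_height cantor_gaps t = 0 \<longleftrightarrow> t \<in> cantor_set"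
proof
  assume 0: "gap_height cantor_gaps t = 0"
  show "t \<in> cantor_set"
  proof (rule ccontr)
    assume "t \<notin> cantor_set"
    then obtain a b where "(a, b) \<in> cantor_gaps" "a < t" "t < b"
      using middle_third_gap_exists[OF assms] by (auto simp: cantor_gaps_eq)
    then show False using 0 gap_height_interior[OF order_refl, of a b t] by simp
  qed
qed (simp add: gap_height_cantor)

lemma upsilon_inf_eq:
  assumes "t \<in> {0..1}" shows "upsilon_inf t = gap_path cantor_gaps t"
proof (cases "t \<in> cantor_set")
  case True
  then show ?thesis by (simp add: upsilon_inf_def gap_path_def gap_height_cantor)
next
  case False
  then have ex: "\<exists>I\<in>cantor_gaps. fst I < t \<and> t < snd I"
    using middle_third_gap_exists[OF assms] by (force simp: cantor_gaps_eq)
  then show ?thesis using False by (simp add: upsilon_inf_def gap_path_def gap_height_def split: prod.split)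
qed

lemma gap_path_empty: "gap_path {} = lambda_inf"
  by (auto simp: gap_path_def lambda_inf_def gap_height_def)

section \<open>The generators of the subgroup of the Cantor test space\<close>

lemma upsilon_inf_cantor: "t \<in> cantor_set \<Longrightarrow> upsilon_inf t = (t, 0)"
  by (simp add: upsilon_inf_def)

lemma path_upsilon_inf: "path upsilon_inf"
  using path_eq[OF path_gap_path[OF order_refl]] upsilon_inf_eq by simp

lemma path_image_upsilon_inf: "path_image upsilon_inf \<subseteq> WW"
  using path_image_gap_path[OF order_refl] upsilon_inf_eq by (auto simp: path_image_def)

lemma path_lambda_inf: "path lambda_inf"
  using path_gap_path[of "{}"] by (simp add: gap_path_empty)

lemma path_image_lambda_inf: "path_image lambda_inf \<subseteq> {0..1} \<times> {0}"
  by (auto simp: path_image_def lambda_inf_def)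

lemma path_image_lambda_inf_WW: "path_image lambda_inf \<subseteq> WW"
  using path_image_lambda_inf WW_base by blast

lemma gap_cantor:
  assumes "(a, b) \<in> cantor_gaps"
  shows "a \<in> cantor_set" "b \<in> cantor_set" "a \<in> {0..1}" "b \<in> {0..1}" "a < b"
  using assms middle_third_gap_cantor cantor_gap_bounds[OF assms] by (auto simp: cantor_gaps_eq)

definition gap_loop :: "real \<Rightarrow> real \<Rightarrow> real \<Rightarrow> real \<times> real" where
  "gap_loop a b = subpath 0 b upsilon_inf +++ reversepath (subpath a b lambda_inf)
     +++ reversepath (subpath 0 a upsilon_inf)"

lemma gap_loop_pieces:
  assumes "(a, b) \<in> cantor_gaps"
  shows "path (subpath 0 b upsilon_inf)" "path_image (subpath 0 b upsilon_inf) \<subseteq> WW"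
    "path (subpath 0 a upsilon_inf)" "path_image (subpath 0 a upsilon_inf) \<subseteq> WW"
    "path (subpath a b lambda_inf)" "path_image (subpath a b lambda_inf) \<subseteq> WW"
    "upsilon_inf 0 = d0" "upsilon_inf a = (a, 0)" "upsilon_inf b = (b, 0)"
  using gap_cantor[OF assms] path_upsilon_inf path_image_upsilon_inf
    path_lambda_inf path_image_lambda_inf_WW cantor_set_ends(1)
    path_image_subpath_subset[of 0 b upsilon_inf] path_image_subpath_subset[of 0 a upsilon_inf]
    path_image_subpath_subset[of a b lambda_inf]
  by (auto simp: d0_def upsilon_inf_cantor)

lemma gap_loop_loop:
  assumes "(a, b) \<in> cantor_gaps"
  shows "gap_loop a b \<in> loops_at WW d0"
  unfolding gap_loop_def
  by (rule loops_atI) (use gap_loop_pieces[OF assms] in \<open>auto simp: path_image_join lambda_inf_def\<close>)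

lemma W_subgroup_eq:
  "W_subgroup = generate (fundamental_group WW d0)
     {path_class WW (gap_loop a b) | a b. (a, b) \<in> cantor_gaps}"
  by (simp add: W_subgroup_def gap_loop_def)

lemma d0_WW: "d0 \<in> WW" using WW_base[of 0] by (simp add: d0_def)

lemma subgroup_W: "subgroup W_subgroup (fundamental_group WW d0)"
  unfolding W_subgroup_eq
  by (rule group.generate_is_subgroup[OF group_fundamental_group[OF d0_WW]])
     (use gap_loop_loop in \<open>fastforce simp: fundamental_group_carrier\<close>)

section \<open>The map from the Cantor to the dyadic test space\<close>

text \<open>
  The base is sent to the base by the Cantor function, and the upper arc along the ramified path. The
  case distinction is consistent because base and upper arc meet exactly over the Cantor set, where
  the two paths agree.
\<close>

definition W_to_D :: "real \<times> real \<Rightarrow> real \<times> real" where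
  "W_to_D z = (if snd z = 0 then staircase_path (fst z) else ramified_path (fst z))"

lemma W_to_D_lambda: "W_to_D (t, 0) = staircase_path t"
  by (simp add: W_to_D_def)

lemma W_to_D_d0: "W_to_D d0 = d0"
  using staircase_path_path(3) by (simp add: d0_def W_to_D_lambda pathstart_def)

lemma W_to_D_upsilon: "t \<in> {0..1} \<Longrightarrow> W_to_D (gap_path cantor_gaps t) = ramified_path t"
  using gap_height_zero_iff[of t] ramified_eq_staircase[of t]
  by (auto simp: W_to_D_def gap_path_def)

lemma W_to_D_DD: "W_to_D ` WW \<subseteq> DD"
  using staircase_path_path(2) ramified_path_path(2)
  by (auto simp: WW_eq W_to_D_lambda W_to_D_upsilon path_image_def)

lemma continuous_on_W_to_D: "continuous_on WW W_to_D"
  unfolding WW_eq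
proof (rule continuous_on_closed_Un)
  show "closed ({0..1::real} \<times> {0::real})" by (intro closed_Times) auto
  have "compact (gap_path cantor_gaps ` {0..1})"
    using path_gap_path[OF order_refl] by (intro compact_continuous_image) (auto simp: path_def)
  then show "closed (gap_path cantor_gaps ` {0..1})" by (rule compact_imp_closed)
  have "continuous_on ({0..1} \<times> {0}) (\<lambda>z. staircase_path (fst z))"
    using staircase_path_path(1) unfolding path_def
    by (rule continuous_on_compose2) (auto intro: continuous_intros)
  then show "continuous_on ({0..1} \<times> {0}) W_to_D"
    by (rule continuous_on_eq) (auto simp: W_to_D_def)
  have "continuous_on (gap_path cantor_gaps ` {0..1}) (\<lambda>z. ramified_path (fst z))"
    using ramified_path_path(1) unfolding path_def
    by (rule continuous_on_compose2) (auto intro: continuous_intros simp: gap_path_def)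
  then show "continuous_on (gap_path cantor_gaps ` {0..1}) W_to_D"
    by (rule continuous_on_eq) (use W_to_D_upsilon in \<open>auto simp: gap_path_def\<close>)
qed

lemma standardizable_eq:
  assumes "standardizable q" "\<And>t. t \<in> {0..1} \<Longrightarrow> p t = q t"
  shows "standardizable p"
proof -
  have "homotopic_paths DD q p"
    using assms standardizableD[OF assms(1)] by (intro homotopic_paths_eq) auto
  then show ?thesis using assms(1) standardizable_homotopic homotopic_paths_sym by blast
qed

lemma standardizable_subpath_trans:
  assumes "path g" "path_image g \<subseteq> DD" "u \<in> {0..1}" "v \<in> {0..1}" "w \<in> {0..1}" "u \<le> v" "v \<le> w"
    and "standardizable (subpath u v g)" "standardizable (subpath v w g)"
  shows "standardizable (subpath u w g)"
proof (rule standardizable_homotopic)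
  show "homotopic_paths DD (subpath u w g) (subpath u v g +++ subpath v w g)"
    by (rule homotopic_paths_sym, rule homotopic_join_subpaths1) (use assms in auto)
  show "standardizable (subpath u v g +++ subpath v w g)"
    using assms by (intro standardizable_join) auto
qed

lemma unit_interval_affine:
  assumes "t \<in> {0..1}" "u \<in> {0..1}" "v \<in> {0..1}"
  shows "(v - u) * t + u \<in> {0..(1::real)}"
proof -
  have "(v - u) * t + u = (1 - t) * u + t * v" by (simp add: algebra_simps)
  moreover have "(1 - t) * u + t * v \<le> (1 - t) * 1 + t * 1"
    using assms by (intro add_mono mult_left_mono) auto
  ultimately show ?thesis using assms by auto
qed

text \<open>
  Over the outer thirds the ramified path is a half-size copy of itself, and the similarities preserve
  standardizability.
\<close>

lemma subpath_ramified_left: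
  assumes "standardizable (subpath u v ramified_path)" "u \<in> {0..1}" "v \<in> {0..1}"
  shows "standardizable (subpath (u / 3) (v / 3) ramified_path)"
proof (rule standardizable_eq[OF standardizable_left_half[OF assms(1)]])
  fix t :: real assume t: "t \<in> {0..1}"
  have "(v / 3 - u / 3) * t + u / 3 = ((v - u) * t + u) / 3" by (simp add: field_simps)
  then show "subpath (u / 3) (v / 3) ramified_path t = (left_half \<circ> subpath u v ramified_path) t"
    using ramified_path_rec(1)[OF unit_interval_affine[OF t assms(2,3)]]
    by (simp only: subpath_def o_apply)
qed

lemma subpath_ramified_right:
  assumes "standardizable (subpath u v ramified_path)" "u \<in> {0..1}" "v \<in> {0..1}"
  shows "standardizable (subpath ((u + 2) / 3) ((v + 2) / 3) ramified_path)"
proof (rule standardizable_eq[OF standardizable_right_half[OF assms(1)]])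
  fix t :: real assume t: "t \<in> {0..1}"
  have "((v + 2) / 3 - (u + 2) / 3) * t + (u + 2) / 3 = (((v - u) * t + u) + 2) / 3"
    by (simp add: field_simps)
  then show "subpath ((u + 2) / 3) ((v + 2) / 3) ramified_path t =
      (right_half \<circ> subpath u v ramified_path) t"
    using ramified_path_rec(3)[OF unit_interval_affine[OF t assms(2,3)]]
    by (simp only: subpath_def o_apply)
qed

lemma standardizable_ramified_path: "standardizable ramified_path"
  using standardizable_homotopic homotopic_paths_sym ramified_path(1) standardizable_top by blast

lemma standardizable_ramified_thirds:
  "standardizable (subpath 0 (1/3) ramified_path)" "standardizable (subpath (1/3) (2/3) ramified_path)"
  "standardizable (subpath 0 (2/3) ramified_path)"
proof -
  show 1: "standardizable (subpath 0 (1/3) ramified_path)"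
    using subpath_ramified_left[of 0 1] standardizable_ramified_path by simp
  show 2: "standardizable (subpath (1/3) (2/3) ramified_path)"
  proof (rule standardizable_eq[OF standardizable_boundary_loop])
    fix t :: real assume t: "t \<in> {0..1}"
    have "(2/3 - 1/3) * t + 1/3 = (t + 1) / 3" by (simp add: field_simps)
    then show "subpath (1/3) (2/3) ramified_path t = boundary_loop t"
      using ramified_path_rec(2)[OF t] by (simp only: subpath_def)
  qed
  show "standardizable (subpath 0 (2/3) ramified_path)"
    by (rule standardizable_subpath_trans[OF _ _ _ _ _ _ _ 1 2]) (use ramified_path_path in auto)
qed

text \<open>
  Up to a gap, the ramified path has made infinitely many detours, and yet it is homotopic to a
  finite concatenation: over the first third it is a copy of the whole path, hence homotopic to one
  standard arc, and the induction over gaps continues this.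
\<close>

lemma standardizable_ramified_gap:
  "(a, b) \<in> middle_third_gaps \<Longrightarrow>
     standardizable (subpath 0 a ramified_path) \<and> standardizable (subpath a b ramified_path)"
proof (induction rule: middle_third_gaps.induct)
  case middle
  show ?case using standardizable_ramified_thirds by simp
next
  case (left a b)
  then show ?case
    using subpath_ramified_left[of 0 a] subpath_ramified_left[of a b]
      middle_third_gaps_bounds[OF left(1)] by simp
next
  case (right a b)
  have ab: "0 < a" "a < b" "b < 1" using middle_third_gaps_bounds[OF right(1)] by auto
  have "standardizable (subpath (2/3) ((a + 2) / 3) ramified_path)"
    using subpath_ramified_right[of 0 a] right ab by simp
  then have "standardizable (subpath 0 ((a + 2) / 3) ramified_path)"
    by (intro standardizable_subpath_trans[OF _ _ _ _ _ _ _ standardizable_ramified_thirds(3)])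
      (use ramified_path_path ab in auto)
  moreover have "standardizable (subpath ((a + 2) / 3) ((b + 2) / 3) ramified_path)"
    using subpath_ramified_right[of a b] right ab by simp
  ultimately show ?case by simp
qed

lemma staircase_const_gap:
  "(a, b) \<in> middle_third_gaps \<Longrightarrow> t \<in> {a..b} \<Longrightarrow> staircase_path t = staircase_path a"
proof (induction arbitrary: t rule: middle_third_gaps.induct)
  case middle
  then show ?case
    using staircase_path_rec(2)[of "3 * t - 1"] staircase_path_rec(2)[of 0] by simp
next
  case (left a b)
  note ab = middle_third_gaps_bounds[OF left(1)]
  have t: "3 * t \<in> {a..b}" using left.prems by auto
  have "staircase_path (3 * t / 3) = left_half (staircase_path (3 * t))"
    by (rule staircase_path_rec) (use t ab in auto)
  also have "\<dots> = left_half (staircase_path a)" using left.IH[OF t] by (rule arg_cong)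
  also have "\<dots> = staircase_path (a / 3)"
    by (rule staircase_path_rec[symmetric]) (use ab in auto)
  finally show ?case by simp
next
  case (right a b)
  note ab = middle_third_gaps_bounds[OF right(1)]
  have t: "3 * t - 2 \<in> {a..b}" using right.prems by auto
  have "staircase_path (((3 * t - 2) + 2) / 3) = right_half (staircase_path (3 * t - 2))"
    by (rule staircase_path_rec) (use t ab in auto)
  also have "\<dots> = right_half (staircase_path a)" using right.IH[OF t] by (rule arg_cong)
  also have "\<dots> = staircase_path ((a + 2) / 3)"
    by (rule staircase_path_rec[symmetric]) (use ab in auto)
  finally show ?case by simp
qed

text \<open>
  The base over the gap is collapsed to a point, so the image of the loop runs along the ramified path
  up to b and back from a.
\<close>

lemma standardizable_gap_loop:
  assumes G: "(a, b) \<in> cantor_gaps"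
  shows "standardizable (W_to_D \<circ> gap_loop a b)"
proof -
  note ab = gap_cantor[OF G]
  have G': "(a, b) \<in> middle_third_gaps" using G by (simp add: cantor_gaps_eq)
  define c where "c = ramified_path a"
  have c: "c = staircase_path a" using ramified_eq_staircase ab by (simp add: c_def)
  have up: "(W_to_D \<circ> upsilon_inf) t = ramified_path t" if "t \<in> {0..1}" for t
    using that by (simp add: upsilon_inf_eq W_to_D_upsilon)
  define m where "m = reversepath (subpath a b (W_to_D \<circ> lambda_inf))"
  define r where "r = reversepath (subpath 0 a ramified_path)"
  have m: "m t = c" if "t \<in> {0..1}" for t
  proof -
    have t': "1 - t \<in> {0..1}" using that by auto
    have "(b - a) * (1 - t) \<le> (b - a) * 1" using ab t' by (intro mult_left_mono) auto
    moreover have "0 \<le> (b - a) * (1 - t)" using ab t' by auto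
    ultimately have "(b - a) * (1 - t) + a \<in> {a..b}" by simp
    from staircase_const_gap[OF G' this] show ?thesis
      by (simp add: m_def reversepath_def subpath_def lambda_inf_def W_to_D_lambda c)
  qed
  have std: "standardizable (subpath 0 a ramified_path)" "standardizable (subpath a b ramified_path)"
    using standardizable_ramified_gap[OF G'] by auto
  have r: "standardizable r" unfolding r_def by (rule standardizable_reverse[OF std(1)])
  have rs: "pathstart r = c" by (simp add: r_def c_def)
  have cDD: "c \<in> DD" using ramified_path_path(2) ab by (auto simp: c_def path_image_def)
  have "linepath c c t = m t" if "t \<in> {0..1}" for t
    using m[OF that] by (simp add: linepath_const)
  then have "homotopic_paths DD (linepath c c +++ r) (m +++ r)"
    by (intro homotopic_paths_join homotopic_paths_eq) (use r rs cDD standardizableD[OF r] in auto)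
  moreover have "homotopic_paths DD (linepath c c +++ r) r"
    by (intro homotopic_paths_lid') (use r rs standardizableD in auto)
  ultimately have mr: "standardizable (m +++ r)"
    using r standardizable_homotopic homotopic_paths_sym homotopic_paths_trans by metis
  have "standardizable (subpath 0 b ramified_path)"
    by (rule standardizable_subpath_trans[OF _ _ _ _ _ _ _ std]) (use ramified_path_path ab in auto)
  moreover have "ramified_path b = pathstart (m +++ r)"
    using m[of 0] staircase_const_gap[OF G', of b] ramified_eq_staircase[OF ab(2)] ab(5)
    unfolding pathstart_join by (simp add: c pathstart_def)
  ultimately have "standardizable (subpath 0 b ramified_path +++ (m +++ r))"
    using mr by (intro standardizable_join[of _ "m +++ r"]) simp_all
  then show ?thesis
  proof (rule standardizable_eq)
    fix t :: real assume t: "t \<in> {0..1}"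
    have "W_to_D \<circ> gap_loop a b = subpath 0 b (W_to_D \<circ> upsilon_inf) +++
        (m +++ reversepath (subpath 0 a (W_to_D \<circ> upsilon_inf)))"
      by (simp add: gap_loop_def m_def path_compose_join path_compose_reversepath subpath_image)
    then show "(W_to_D \<circ> gap_loop a b) t = (subpath 0 b ramified_path +++ (m +++ r)) t"
      using t up[OF unit_interval_affine[of _ 0 b]] up[OF unit_interval_affine[of _ 0 a]] ab
      by (simp add: joinpaths_def r_def reversepath_def subpath_def)
  qed
qed

lemma W_subgroup_to_D:
  assumes "A \<in> W_subgroup"
  shows "\<exists>p\<in>loops_at WW d0. A = path_class WW p \<and> standardizable (W_to_D \<circ> p)"
  using assms unfolding W_subgroup_eq
proof (induction rule: generate.induct)
  case one
  have "W_to_D \<circ> (\<lambda>t. d0) = (\<lambda>t::real. d0)" by (auto simp: W_to_D_d0)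
  then show ?case
    using const_loop[OF d0_WW] standardizable_const by (auto simp: fundamental_group_one)
next
  case (incl h)
  then show ?case using gap_loop_loop standardizable_gap_loop by blast
next
  case (inv h)
  then obtain a b where ab: "(a, b) \<in> cantor_gaps" "h = path_class WW (gap_loop a b)" by blast
  show ?case
    using fundamental_group_inv[OF gap_loop_loop[OF ab(1)]] loops_at_reversepath[OF gap_loop_loop[OF ab(1)]]
      standardizable_reverse[OF standardizable_gap_loop[OF ab(1)]]
    by (intro bexI[of _ "reversepath (gap_loop a b)"]) (auto simp: ab(2) path_compose_reversepath)
next
  case (eng h1 h2)
  then obtain p q where p: "p \<in> loops_at WW d0" "h1 = path_class WW p" "standardizable (W_to_D \<circ> p)"
    and q: "q \<in> loops_at WW d0" "h2 = path_class WW q" "standardizable (W_to_D \<circ> q)" by blast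
  have "standardizable (W_to_D \<circ> (p +++ q))"
    unfolding path_compose_join using p q
    by (intro standardizable_join) (auto simp: loops_at_def pathfinish_compose pathstart_compose)
  then show ?case
    using p q loops_at_join[OF p(1) q(1)]
    by (intro bexI[of _ "p +++ q"]) (simp_all add: path_class_mult del: comp_apply)
qed

lemma w_inf_loop: "upsilon_inf +++ reversepath lambda_inf \<in> loops_at WW d0"
  unfolding loops_at_def mem_Collect_eq
proof (intro conjI)
  have ends: "pathfinish upsilon_inf = pathfinish lambda_inf" "pathstart upsilon_inf = d0"
    "pathstart lambda_inf = d0"
    by (auto simp: pathstart_def pathfinish_def lambda_inf_def d0_def
        upsilon_inf_cantor cantor_set_ends)
  show "path (upsilon_inf +++ reversepath lambda_inf)"
    using path_upsilon_inf path_lambda_inf ends by simp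
  show "path_image (upsilon_inf +++ reversepath lambda_inf) \<subseteq> WW"
    using path_image_upsilon_inf path_image_lambda_inf_WW ends by (simp add: path_image_join)
qed (auto simp: pathstart_def pathfinish_def lambda_inf_def d0_def reversepath_def joinpaths_def
    upsilon_inf_cantor cantor_set_ends)

lemma W_to_D_w_inf: "path_class DD (W_to_D \<circ> (upsilon_inf +++ reversepath lambda_inf)) = d_inf"
proof -
  have "homotopic_paths DD ramified_path (W_to_D \<circ> upsilon_inf)"
    by (intro homotopic_paths_eq) (use ramified_path_path in \<open>auto simp: upsilon_inf_eq W_to_D_upsilon\<close>)
  then have 1: "homotopic_paths DD big_arc (W_to_D \<circ> upsilon_inf)"
    using ramified_path(1) homotopic_paths_trans by blast
  have "W_to_D \<circ> lambda_inf = staircase_path"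
    by (auto simp: lambda_inf_def W_to_D_lambda)
  then have 2: "homotopic_paths DD lambda_inf (W_to_D \<circ> lambda_inf)" using staircase_path_DD by simp
  have "homotopic_paths DD (big_arc +++ reversepath lambda_inf)
     (W_to_D \<circ> (upsilon_inf +++ reversepath lambda_inf))"
    unfolding path_compose_join path_compose_reversepath
    by (intro homotopic_paths_join homotopic_paths_reversepath_D 1 2)
      (use big_arc_ends in \<open>auto simp: pathfinish_def lambda_inf_def\<close>)
  then show ?thesis unfolding d_inf_def by (rule path_class_cong[symmetric])
qed

lemma closed_D_if_closed_W:
  assumes "closed_subgroup WW d0 W_subgroup w_inf X x0 H"
  shows "closed_subgroup DD d0 D_subgroup d_inf X x0 H"
proof (rule closed_subgroup_pullback[OF assms continuous_on_W_to_D W_to_D_DD W_to_D_d0 _ w_inf_def w_inf_loop W_to_D_w_inf[symmetric]])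
  fix A assume "A \<in> W_subgroup"
  then obtain p where p: "p \<in> loops_at WW d0" "A = path_class WW p" "standardizable (W_to_D \<circ> p)"
    using W_subgroup_to_D by blast
  then have "path_class DD (W_to_D \<circ> p) \<in> D_subgroup"
    using W_to_D_d0 by (intro standardizable_D_subgroup)
      (auto simp: loops_at_def pathstart_compose pathfinish_compose)
  then show "\<exists>p\<in>loops_at WW d0. A = path_class WW p \<and> path_class DD (W_to_D \<circ> p) \<in> D_subgroup"
    using p by blast
qed

section \<open>Cosets of paths\<close>

lemma homotopic_cancel_middle:
  fixes X :: "'a::real_normed_vector set"
  assumes "path p" "path_image p \<subseteq> X" "path s" "path_image s \<subseteq> X" "path r" "path_image r \<subseteq> X"
    and "pathfinish p = pathstart s" "pathstart r = pathstart s"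
  shows "homotopic_paths X ((p +++ s) +++ (reversepath s +++ r)) (p +++ r)"
proof -
  have "homotopic_paths X (p +++ (s +++ (reversepath s +++ r))) ((p +++ s) +++ (reversepath s +++ r))"
    by (rule homotopic_paths_assoc) (use assms in \<open>auto simp: path_image_join\<close>)
  moreover have "homotopic_paths X (p +++ (s +++ (reversepath s +++ r))) (p +++ ((s +++ reversepath s) +++ r))"
    by (intro homotopic_paths_join homotopic_paths_assoc) (use assms in \<open>auto simp: path_image_join\<close>)
  moreover have "homotopic_paths X (p +++ ((s +++ reversepath s) +++ r))
      (p +++ (linepath (pathstart s) (pathstart s) +++ r))"
    by (intro homotopic_paths_join homotopic_paths_rinv) (use assms in auto)
  moreover have "homotopic_paths X (p +++ (linepath (pathstart s) (pathstart s) +++ r)) (p +++ r)"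
    by (intro homotopic_paths_join homotopic_paths_lid') (use assms in auto)
  ultimately show ?thesis by (meson homotopic_paths_sym homotopic_paths_trans)
qed

text \<open>
  Based paths with a common end point represent the same right coset of H. Working with this relation
  on paths instead of loops allows a concatenation of standard paths to be treated one path at a time.
\<close>

definition same_coset ::
    "'a::real_normed_vector set \<Rightarrow> 'a \<Rightarrow> (real \<Rightarrow> 'a) set set \<Rightarrow> (real \<Rightarrow> 'a) \<Rightarrow> (real \<Rightarrow> 'a) \<Rightarrow> bool"
  where "same_coset X x H p q \<longleftrightarrow>
    path p \<and> path_image p \<subseteq> X \<and> pathstart p = x \<and> path q \<and> path_image q \<subseteq> X \<and> pathstart q = x \<and>
    pathfinish p = pathfinish q \<and> path_class X (p +++ reversepath q) \<in> H"

lemma same_coset_loop: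
  "same_coset X x H p q \<Longrightarrow> p +++ reversepath q \<in> loops_at X x"
  unfolding same_coset_def by (intro loops_atI) (auto simp: path_image_join)

lemma same_coset_homotopic:
  assumes H: "subgroup H (fundamental_group X x)" and hom: "homotopic_paths X p q" "pathstart p = x"
  shows "same_coset X x H p q"
proof -
  have pq: "path p" "path q" "path_image p \<subseteq> X" "path_image q \<subseteq> X" "pathstart q = x"
    "pathfinish p = pathfinish q"
    using hom homotopic_paths_imp_path homotopic_paths_imp_subset homotopic_paths_imp_pathstart
      homotopic_paths_imp_pathfinish by metis+
  have "homotopic_paths X (p +++ reversepath q) (q +++ reversepath q)"
    by (intro homotopic_paths_join hom) (use pq in auto)
  also have "homotopic_paths X (q +++ reversepath q) (\<lambda>t. x)"
    using homotopic_paths_rinv[of q X] pq by (simp add: linepath_const)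
  finally have "path_class X (p +++ reversepath q) = \<one>\<^bsub>fundamental_group X x\<^esub>"
    unfolding fundamental_group_one by (rule path_class_cong)
  then show ?thesis
    using subgroup.one_closed[OF H] pq hom unfolding same_coset_def by simp
qed

lemma same_coset_sym:
  assumes H: "subgroup H (fundamental_group X x)" and pq: "same_coset X x H p q"
  shows "same_coset X x H q p"
proof -
  have x: "x \<in> X" using pq unfolding same_coset_def path_image_def pathstart_def by force
  have "reversepath (p +++ reversepath q) = q +++ reversepath p"
    using pq by (subst reversepath_joinpaths) (auto simp: same_coset_def)
  then have "path_class X (q +++ reversepath p) = inv\<^bsub>fundamental_group X x\<^esub> path_class X (p +++ reversepath q)"
    using fundamental_group_inv[OF same_coset_loop[OF pq]] by simp
  also have "\<dots> \<in> H"
    using subgroup.m_inv_closed[OF H] pq by (auto simp: same_coset_def)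
  finally show ?thesis using pq by (simp add: same_coset_def)
qed

lemma same_coset_trans:
  assumes H: "subgroup H (fundamental_group X x)"
    and pq: "same_coset X x H p q" and qr: "same_coset X x H q r"
  shows "same_coset X x H p r"
proof -
  have "homotopic_paths X ((p +++ reversepath q) +++ (reversepath (reversepath q) +++ reversepath r))
      (p +++ reversepath r)"
    by (rule homotopic_cancel_middle) (use pq qr in \<open>auto simp: same_coset_def\<close>)
  then have "path_class X (p +++ reversepath r) =
      path_class X ((p +++ reversepath q) +++ (q +++ reversepath r))"
    by (simp add: path_class_cong)
  also have "\<dots> = path_class X (p +++ reversepath q) \<otimes>\<^bsub>fundamental_group X x\<^esub>
      path_class X (q +++ reversepath r)"
    by (rule path_class_mult[symmetric]) (use same_coset_loop pq qr in blast)+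
  also have "\<dots> \<in> H"
    using subgroup.m_closed[OF H] pq qr by (auto simp: same_coset_def)
  finally show ?thesis using pq qr by (simp add: same_coset_def)
qed

lemma same_coset_join:
  assumes pq: "same_coset X x H p q"
    and s: "path s" "path_image s \<subseteq> X" "pathstart s = pathfinish p"
  shows "same_coset X x H (p +++ s) (q +++ s)"
proof -
  have rev: "reversepath (q +++ s) = reversepath s +++ reversepath q"
    using pq s by (simp add: reversepath_joinpaths same_coset_def)
  have "homotopic_paths X ((p +++ s) +++ (reversepath s +++ reversepath q)) (p +++ reversepath q)"
    by (rule homotopic_cancel_middle) (use pq s in \<open>auto simp: same_coset_def\<close>)
  then have "path_class X ((p +++ s) +++ reversepath (q +++ s)) = path_class X (p +++ reversepath q)"
    unfolding rev by (rule path_class_cong)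
  then show ?thesis using pq s by (auto simp: same_coset_def path_image_join)
qed

section \<open>The map from the dyadic to the Cantor test space\<close>

text \<open>
  The path over [u,v] that is assigned to the dyadic arc with end points u and v follows exactly the
  semicircles over these gaps. A gap that contains u or v in its interior is crossed along the base,
  since the arc has to begin and end on the base.
\<close>

definition gaps_within :: "real \<Rightarrow> real \<Rightarrow> (real \<times> real) set" where
  "gaps_within u v = {(a, b) \<in> cantor_gaps. u \<le> a \<and> b \<le> v}"

lemma gaps_within_subset: "gaps_within u v \<subseteq> cantor_gaps"
  by (auto simp: gaps_within_def)

lemma gaps_within_all: "gaps_within 0 1 = cantor_gaps"
  using cantor_gap_bounds by (force simp: gaps_within_def)

lemma gap_height_within_le:
  assumes "u \<le> x" "x \<le> v"
  shows "gap_height (gaps_within u v) x \<le> sqrt ((x - u) * (v - x))"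
proof (cases "\<exists>(a, b)\<in>gaps_within u v. a < x \<and> x < b")
  case True
  then obtain a b where ab: "(a, b) \<in> gaps_within u v" "a < x" "x < b" by auto
  then have "(x - a) * (b - x) \<le> (x - u) * (v - x)"
    by (intro mult_mono) (auto simp: gaps_within_def)
  then show ?thesis using gap_height_interior[OF gaps_within_subset ab] by simp
next
  case False
  then have "gap_height (gaps_within u v) x = 0" by (intro gap_height_out) auto
  then show ?thesis using assms by simp
qed

lemma gap_height_within_ends:
  assumes "x = u \<or> x = v" "u \<le> v" shows "gap_height (gaps_within u v) x = 0"
proof -
  have "gap_height (gaps_within u v) x \<le> 0" using gap_height_within_le[of u x v] assms by auto
  then show ?thesis using gap_height_nonneg[OF gaps_within_subset, of u v x] by simp
qed

text \<open>
  Measured in units of the finer scale, the end points of both intervals are integers, and an open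
  interval between consecutive integers cannot contain another integer.
\<close>

lemma dyadic_interval_nested:
  assumes "n \<le> m" "dyadic_left n j < x" "x < dyadic_right n j" "dyadic_left m i < x" "x < dyadic_right m i"
    "1 \<le> n"
  shows "dyadic_left n j \<le> dyadic_left m i" "dyadic_right m i \<le> dyadic_right n j"
proof -
  define d where "d = (2::nat) ^ (m - n)"
  have pw: "(2::real) ^ (m - 1) = real d * 2 ^ (n - 1)"
    using assms(1,6) by (simp add: d_def power_add[symmetric])
  have d: "0 < d" by (simp add: d_def)
  have l: "dyadic_left n j = (real j - 1) * d / 2 ^ (m - 1)" "dyadic_right n j = real j * d / 2 ^ (m - 1)"
    unfolding dyadic_left_def dyadic_right_def pw using d by auto
  have l': "dyadic_left m i = (real i - 1) / 2 ^ (m - 1)" "dyadic_right m i = real i / 2 ^ (m - 1)"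
    by (auto simp: dyadic_left_def dyadic_right_def)
  have "dyadic_left m i < dyadic_right n j" using assms by linarith
  then have "real i - 1 < real j * d" unfolding l l' by (simp add: divide_less_cancel)
  then have "real i < real (j * d + 1)" by simp
  then have "i \<le> j * d" by (simp only: of_nat_less_iff)
  then have ij: "real i \<le> real j * d" by (metis of_nat_le_iff of_nat_mult)
  have "dyadic_left n j < dyadic_right m i" using assms by linarith
  then have "(real j - 1) * d < real i" unfolding l l' by (simp add: divide_less_cancel)
  then have "real (j * d) < real (i + d)" by (simp add: algebra_simps)
  then have "j * d + 1 \<le> i + d" by (simp only: of_nat_less_iff)
  then have "real (j * d + 1) \<le> real (i + d)" by (simp only: of_nat_le_iff)
  then have ji: "(real j - 1) * d \<le> real i - 1" by (simp add: algebra_simps)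
  show "dyadic_left n j \<le> dyadic_left m i"
    unfolding l l' using ji by (intro divide_right_mono) auto
  show "dyadic_right m i \<le> dyadic_right n j"
    unfolding l l' using ij by (intro divide_right_mono) auto
qed

lemma product_strict_nested:
  fixes x :: real
  assumes "u \<le> u'" "u' < x" "x < v'" "v' \<le> v" "(x - u') * (v' - x) = (x - u) * (v - x)"
  shows "u = u' \<and> v = v'"
proof (rule ccontr)
  assume "\<not> (u = u' \<and> v = v')"
  then consider "u < u'" | "v' < v" using assms by linarith
  then have "(x - u') * (v' - x) < (x - u) * (v - x)"
  proof cases
    case 1
    then have "(x - u') * (v' - x) < (x - u) * (v' - x)"
      using assms by (intro mult_strict_right_mono) auto
    also have "\<dots> \<le> (x - u) * (v - x)" using assms by (intro mult_left_mono) auto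
    finally show ?thesis .
  next
    case 2
    have "(x - u') * (v' - x) \<le> (x - u) * (v' - x)" using assms by (intro mult_right_mono) auto
    also have "\<dots> < (x - u) * (v - x)"
      using 2 assms by (intro mult_strict_left_mono) auto
    finally show ?thesis .
  qed
  then show False using assms by simp
qed

lemma dyadic_arc_interior:
  assumes "(n, j) \<in> dyadic_index" "z \<in> dyadic_arc n j" "snd z \<noteq> 0"
  shows "dyadic_left n j < fst z" "fst z < dyadic_right n j"
    "(snd z)\<^sup>2 = (fst z - dyadic_left n j) * (dyadic_right n j - fst z)"
proof -
  have z: "dyadic_left n j \<le> fst z" "fst z \<le> dyadic_right n j"
    "snd z = sqrt ((fst z - dyadic_left n j) * (dyadic_right n j - fst z))"
    using assms(2) dyadic_arc_iff[OF assms(1), of "fst z" "snd z"] by auto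
  then show "(snd z)\<^sup>2 = (fst z - dyadic_left n j) * (dyadic_right n j - fst z)" by simp
  have "fst z \<noteq> dyadic_left n j" "fst z \<noteq> dyadic_right n j" using z(3) assms(3) by auto
  then show "dyadic_left n j < fst z" "fst z < dyadic_right n j" using z by auto
qed

text \<open>
  Two arcs with a common point above the base lie over nested intervals, and of two different nested intervals
  the larger one has the strictly higher arc over every interior point of the smaller one.
\<close>

lemma dyadic_arcs_disjoint:
  assumes nj: "(n, j) \<in> dyadic_index" "z \<in> dyadic_arc n j"
    and mi: "(m, i) \<in> dyadic_index" "z \<in> dyadic_arc m i" and z: "snd z \<noteq> 0"
  shows "dyadic_left n j = dyadic_left m i \<and> dyadic_right n j = dyadic_right m i"
proof -
  note 1 = dyadic_arc_interior[OF nj z] and 2 = dyadic_arc_interior[OF mi z]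
  have pos: "1 \<le> n" "1 \<le> m" using nj(1) mi(1) by (auto simp: dyadic_index_def)
  show ?thesis
  proof (cases "n \<le> m")
    case True
    show ?thesis
      by (rule product_strict_nested[OF dyadic_interval_nested(1)[OF True 1(1,2) 2(1,2) pos(1)]
        2(1,2) dyadic_interval_nested(2)[OF True 1(1,2) 2(1,2) pos(1)]]) (use 1(3) 2(3) in simp)
  next
    case False
    then have le: "m \<le> n" by simp
    have "dyadic_left m i = dyadic_left n j \<and> dyadic_right m i = dyadic_right n j"
      by (rule product_strict_nested[OF dyadic_interval_nested(1)[OF le 2(1,2) 1(1,2) pos(2)]
        1(1,2) dyadic_interval_nested(2)[OF le 2(1,2) 1(1,2) pos(2)]]) (use 1(3) 2(3) in simp)
    then show ?thesis by simp
  qed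
qed

text \<open>
  The first coordinate is kept. An arc over [u,v] is sent to the path that follows the semicircles
  over the gaps within [u,v].
\<close>

definition D_to_W :: "real \<times> real \<Rightarrow> real \<times> real" where
  "D_to_W z = (if snd z = 0 then z else
     let (n, j) = (SOME nj. nj \<in> dyadic_index \<and> z \<in> dyadic_arc (fst nj) (snd nj))
     in gap_path (gaps_within (dyadic_left n j) (dyadic_right n j)) (fst z))"

lemma D_to_W_arc:
  assumes nj: "(n, j) \<in> dyadic_index" "z \<in> dyadic_arc n j"
  shows "D_to_W z = gap_path (gaps_within (dyadic_left n j) (dyadic_right n j)) (fst z)"
proof (cases "snd z = 0")
  case True
  have "snd z = sqrt ((fst z - dyadic_left n j) * (dyadic_right n j - fst z))"
    using nj(2) dyadic_arc_iff[OF nj(1), of "fst z" "snd z"] by simp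
  with True have "fst z = dyadic_left n j \<or> fst z = dyadic_right n j" by auto
  then show ?thesis
    using True gap_height_within_ends dyadic_index_bounds[OF nj(1)]
    by (simp add: D_to_W_def gap_path_def prod_eq_iff)
next
  case False
  let ?P = "\<lambda>nj. nj \<in> dyadic_index \<and> z \<in> dyadic_arc (fst nj) (snd nj)"
  obtain m i where mi: "(SOME nj. ?P nj) = (m, i)" by (cases "SOME nj. ?P nj")
  have "?P (SOME nj. ?P nj)" by (rule someI[of ?P "(n, j)"]) (use nj in simp)
  then have "(m, i) \<in> dyadic_index" "z \<in> dyadic_arc m i" by (auto simp: mi)
  from dyadic_arcs_disjoint[OF nj this False] show ?thesis
    using False by (simp add: D_to_W_def mi)
qed

lemma D_to_W_base: "D_to_W (x, 0) = (x, 0)"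
  by (simp add: D_to_W_def)

lemma D_to_W_WW: "D_to_W ` DD \<subseteq> WW"
proof (rule image_subsetI)
  fix z assume z: "z \<in> DD"
  show "D_to_W z \<in> WW"
  proof (cases "snd z = 0")
    case True
    then show ?thesis using DD_box[of "fst z" "snd z"] z WW_base[of "fst z"]
      by (cases z) (auto simp: D_to_W_base)
  next
    case False
    then obtain n j where nj: "(n, j) \<in> dyadic_index" "z \<in> dyadic_arc n j"
      using z by (cases z) (auto simp: DD_eq)
    have "fst z \<in> {0..1}" using DD_box[of "fst z" "snd z"] z by auto
    then show ?thesis unfolding D_to_W_arc[OF nj] by (rule gap_path_WW[OF gaps_within_subset])
  qed
qed

text \<open>
  Every gap used for an arc lies within the interval below the arc, so its semicircle is lower than
  the arc.
\<close>

lemma D_to_W_height: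
  assumes "z \<in> DD" shows "fst (D_to_W z) = fst z" "0 \<le> snd (D_to_W z)" "snd (D_to_W z) \<le> snd z"
proof -
  have "fst (D_to_W z) = fst z \<and> 0 \<le> snd (D_to_W z) \<and> snd (D_to_W z) \<le> snd z"
  proof (cases "snd z = 0")
    case True then show ?thesis by (simp add: D_to_W_def)
  next
    case False
    then obtain n j where nj: "(n, j) \<in> dyadic_index" "z \<in> dyadic_arc n j"
      using assms by (cases z) (auto simp: DD_eq)
    then have "dyadic_left n j \<le> fst z" "fst z \<le> dyadic_right n j"
      "snd z = sqrt ((fst z - dyadic_left n j) * (dyadic_right n j - fst z))"
      using dyadic_arc_iff[OF nj(1), of "fst z" "snd z"] by auto
    then show ?thesis
      using gap_height_within_le[of "dyadic_left n j" "fst z" "dyadic_right n j"]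
        gap_height_nonneg[OF gaps_within_subset]
      by (simp add: D_to_W_arc[OF nj] gap_path_def)
  qed
  then show "fst (D_to_W z) = fst z" "0 \<le> snd (D_to_W z)" "snd (D_to_W z) \<le> snd z" by auto
qed

lemma continuous_on_D_to_W_arc:
  assumes "(n, j) \<in> dyadic_index" shows "continuous_on (dyadic_arc n j) D_to_W"
proof -
  have "continuous_on (dyadic_arc n j)
      (\<lambda>z. gap_path (gaps_within (dyadic_left n j) (dyadic_right n j)) (fst z))"
    unfolding gap_path_def
    by (intro continuous_intros continuous_on_compose2[OF continuous_on_gap_height[OF gaps_within_subset, of UNIV]]) auto
  then show ?thesis by (rule continuous_on_eq) (simp add: D_to_W_arc[OF assms])
qed

text \<open>
  At points of the base, where the infinitely many arcs accumulate, the map is continuous because it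
  keeps the first coordinate and does not increase the height. Above the base, finitely many closed
  arcs suffice.
\<close>

lemma continuous_on_D_to_W: "continuous_on DD D_to_W"
  unfolding continuous_on_eq_continuous_within
proof
  fix z assume z: "z \<in> DD"
  show "continuous (at z within DD) D_to_W"
  proof (cases "snd z = 0")
    case True
    have "dist (D_to_W w) (D_to_W z) \<le> dist w z" if "w \<in> DD" for w
      using D_to_W_height[OF that] True
      by (auto simp: D_to_W_def[of z] dist_prod_def dist_real_def power_mono intro!: add_mono)
    then show ?thesis unfolding continuous_within_eps_delta by (meson le_less_trans)
  next
    case False
    then have pos: "0 < snd z / 2" using DD_box[of "fst z" "snd z"] z by auto
    obtain F where F: "finite F" "F \<subseteq> dyadic_index"
      "DD \<subseteq> {z'. snd z' \<le> snd z / 2} \<union> (\<Union>(n, j)\<in>F. dyadic_arc n j)"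
      using DD_locally_finite[OF pos] by blast
    define A where "A = (\<Union>nj\<in>F. dyadic_arc (fst nj) (snd nj))"
    define U where "U = {z' :: real \<times> real. snd z / 2 < snd z'}"
    have "continuous_on A D_to_W"
      unfolding A_def using F(1,2)
      by (intro continuous_on_closed_Union continuous_on_D_to_W_arc)
        (auto simp: dyadic_arc_def closed_upper_semicircle)
    moreover have sub: "DD \<inter> U \<subseteq> A" using F(3) by (force simp: A_def U_def)
    ultimately have "continuous_on (DD \<inter> U) D_to_W" using continuous_on_subset by blast
    moreover have "z \<in> DD \<inter> U" using z pos by (auto simp: U_def)
    ultimately have "continuous (at z within DD \<inter> U) D_to_W"
      by (simp add: continuous_on_eq_continuous_within)
    moreover have "open U" unfolding U_def by (intro open_Collect_less continuous_intros)
    then have "at z within DD = at z within (DD \<inter> U)"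
      using \<open>z \<in> DD \<inter> U\<close> by (intro at_within_nhd[of z U]) auto
    ultimately show ?thesis by simp
  qed
qed

lemma D_to_W_dyadic_path:
  assumes nj: "(n, j) \<in> dyadic_index" and t: "t \<in> {0..1}"
  shows "D_to_W (dyadic_path n j t) =
    subpath (dyadic_left n j) (dyadic_right n j) (gap_path (gaps_within (dyadic_left n j) (dyadic_right n j))) t"
proof -
  have "fst (dyadic_path n j t) = (dyadic_right n j - dyadic_left n j) * t + dyadic_left n j"
    unfolding dyadic_length by (simp add: dyadic_path_def dyadic_left_def field_simps)
  then show ?thesis
    using D_to_W_arc[OF nj dyadic_path_arc[OF nj t]] by (simp add: subpath_def)
qed

section \<open>Standard paths respect the cosets\<close>

abbreviation W_equiv :: "(real \<Rightarrow> real \<times> real) \<Rightarrow> (real \<Rightarrow> real \<times> real) \<Rightarrow> bool" where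
  "W_equiv \<equiv> same_coset WW d0 W_subgroup"

lemma gap_height_cong:
  assumes "E \<subseteq> cantor_gaps" "F \<subseteq> cantor_gaps"
    and EF: "\<And>a b. \<lbrakk>(a, b) \<in> cantor_gaps; a < t; t < b\<rbrakk> \<Longrightarrow> (a, b) \<in> E \<longleftrightarrow> (a, b) \<in> F"
  shows "gap_height E t = gap_height F t"
proof (cases "\<exists>(a, b)\<in>E. a < t \<and> t < b")
  case True
  then obtain a b where ab: "(a, b) \<in> E" "a < t" "t < b" by auto
  moreover have "(a, b) \<in> F" using EF[of a b] ab assms(1) by blast
  ultimately show ?thesis
    using gap_height_interior[OF assms(1) ab] gap_height_interior[OF assms(2)] by simp
next
  case False
  then have "\<not> (a < t \<and> t < b)" if "(a, b) \<in> F" for a b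
    using EF[of a b] that assms(2) by blast
  then show ?thesis using False gap_height_out[of E t] gap_height_out[of F t] by auto
qed

lemma subpath_between:
  assumes "u \<le> v" "t \<in> {0..1::real}" shows "u \<le> (v - u) * t + u" "(v - u) * t + u \<le> v"
proof -
  have "(v - u) * t \<le> (v - u) * 1" using assms by (intro mult_left_mono) auto
  then show "(v - u) * t + u \<le> v" by simp
  show "u \<le> (v - u) * t + u" using assms by simp
qed

lemma homotopic_subpath_eq:
  assumes "path g" "path_image g \<subseteq> S" "u \<in> {0..1}" "v \<in> {0..1}" "u \<le> v"
    and "\<And>t. \<lbrakk>u \<le> t; t \<le> v\<rbrakk> \<Longrightarrow> g t = h t"
  shows "homotopic_paths S (subpath u v g) (subpath u v h)"
proof (rule homotopic_paths_eq)
  show "path (subpath u v g)" using assms by simp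
  show "path_image (subpath u v g) \<subseteq> S"
    using path_image_subpath_subset[of u v g] assms by auto
qed (use assms subpath_between in \<open>auto simp: subpath_def\<close>)

lemma gap_path_eqI:
  assumes "E \<subseteq> cantor_gaps" "F \<subseteq> cantor_gaps"
    and "\<And>a b. \<lbrakk>(a, b) \<in> cantor_gaps; a < t; t < b\<rbrakk> \<Longrightarrow> (a, b) \<in> E \<longleftrightarrow> (a, b) \<in> F"
  shows "gap_path E t = gap_path F t"
  using gap_height_cong[OF assms] by (simp add: gap_path_def)

text \<open>
  A representative of the coset that belongs to the vertex v. All standard paths will turn out to map
  these cosets to each other.
\<close>

definition vertex_path :: "real \<Rightarrow> real \<Rightarrow> real \<times> real" where
  "vertex_path v = subpath 0 v (gap_path (gaps_within 0 v))"

lemma gap_path_piece: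
  assumes "E \<subseteq> cantor_gaps" "u \<in> {0..1}" "v \<in> {0..1}"
  shows "path (subpath u v (gap_path E))" "path_image (subpath u v (gap_path E)) \<subseteq> WW"
  using assms path_gap_path[OF assms(1)] path_image_gap_path[OF assms(1)]
    path_image_subpath_subset[of u v "gap_path E"] by auto

lemma gap_path_0: "E \<subseteq> cantor_gaps \<Longrightarrow> gap_path E 0 = d0"
  using gap_height_cantor[OF _ cantor_set_ends(1)] by (simp add: gap_path_def d0_def)

lemma vertex_path:
  assumes "v \<in> {0..1}"
  shows "path (vertex_path v)" "path_image (vertex_path v) \<subseteq> WW"
    "pathstart (vertex_path v) = d0" "pathfinish (vertex_path v) = (v, 0)"
  unfolding vertex_path_def using gap_path_piece[OF gaps_within_subset, of 0 v 0 v] assms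
    gap_path_0[OF gaps_within_subset] gap_height_within_ends[of v 0 v]
  by (auto simp: gap_path_def)

lemma W_equiv_homotopic:
  "\<lbrakk>homotopic_paths WW p q; pathstart p = d0\<rbrakk> \<Longrightarrow> W_equiv p q"
  by (rule same_coset_homotopic[OF subgroup_W])

lemmas W_equiv_trans = same_coset_trans[OF subgroup_W]
lemmas W_equiv_sym = same_coset_sym[OF subgroup_W]

lemma W_equiv_gap:
  assumes G: "(a, b) \<in> cantor_gaps"
  shows "W_equiv (subpath 0 b upsilon_inf) (subpath 0 a upsilon_inf +++ subpath a b lambda_inf)"
proof -
  note pc = gap_loop_pieces[OF G]
  have "gap_loop a b = subpath 0 b upsilon_inf +++
      reversepath (subpath 0 a upsilon_inf +++ subpath a b lambda_inf)"
    unfolding gap_loop_def using pc by (subst reversepath_joinpaths) (auto simp: lambda_inf_def)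
  moreover have "path_class WW (gap_loop a b) \<in> W_subgroup"
    unfolding W_subgroup_eq using G by (intro generate.incl) blast
  ultimately show ?thesis
    using pc by (auto simp: same_coset_def path_image_join lambda_inf_def)
qed

text \<open>
  Replacing the base over one gap by its semicircle does not change the coset. The generator of
  \<^const>\<open>W_subgroup\<close> for this gap compares the two ways to cross it, provided that the path up to
  the gap is the arc \<^const>\<open>upsilon_inf\<close>; this is why all gaps below a are required to lie in E.
\<close>

lemma W_equiv_insert_gap:
  assumes E: "E \<subseteq> cantor_gaps" and F: "F = insert (a, b) E" and G: "(a, b) \<in> cantor_gaps" "(a, b) \<notin> E"
    and below: "\<And>c d. \<lbrakk>(c, d) \<in> cantor_gaps; d \<le> a\<rbrakk> \<Longrightarrow> (c, d) \<in> E"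
    and v: "b \<le> v" "v \<le> 1"
  shows "W_equiv (subpath 0 v (gap_path F)) (subpath 0 v (gap_path E))"
proof -
  note ab = gap_cantor[OF G(1)] and bd = cantor_gap_bounds[OF G(1)]
  have Fg: "F \<subseteq> cantor_gaps" using E F G by auto
  have v01: "v \<in> {0..1}" using v bd by auto
  note pE = path_gap_path[OF E] path_image_gap_path[OF E]
  note pF = path_gap_path[OF Fg] path_image_gap_path[OF Fg]
  have sep: "d \<le> a \<or> (c, d) = (a, b)" if "(c, d) \<in> cantor_gaps" "c < t" "t < d" "t \<le> b" for c d t
    using gap_ends_outside[OF G(1) that(1)] that cantor_gaps_disjoint[OF G(1) that(1), of t]
      gap_ends_outside[OF that(1) G(1)] by force
  have Fu: "gap_path F t = upsilon_inf t" if "0 \<le> t" "t \<le> b" for t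
  proof -
    have "gap_path F t = gap_path cantor_gaps t"
    proof (rule gap_path_eqI[OF Fg order_refl])
      fix c d assume cd: "(c, d) \<in> cantor_gaps" "c < t" "t < d"
      from sep[OF cd that(2)] show "(c, d) \<in> F \<longleftrightarrow> (c, d) \<in> cantor_gaps"
        using cd(1) below[OF cd(1)] F by auto
    qed
    then show ?thesis using that bd by (simp add: upsilon_inf_eq)
  qed
  have uE: "upsilon_inf t = gap_path E t" if "0 \<le> t" "t \<le> a" for t
  proof -
    have "gap_path E t = gap_path F t"
      by (rule gap_path_eqI[OF E Fg]) (use that F in auto)
    then show ?thesis using that Fu bd by simp
  qed
  have lE: "lambda_inf t = gap_path E t" if "a \<le> t" "t \<le> b" for t
  proof -
    have "gap_path E t = gap_path {} t"
    proof (rule gap_path_eqI[OF E])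
      fix c d assume cd: "(c, d) \<in> cantor_gaps" "c < t" "t < d"
      then show "((c, d) \<in> E) = ((c, d) \<in> {})" using sep[OF cd that(2)] that G(2) by auto
    qed simp
    then show ?thesis by (simp add: gap_path_empty)
  qed
  have FE: "gap_path F t = gap_path E t" if "b \<le> t" for t
    by (rule gap_path_eqI[OF Fg E]) (use that F in auto)
  have "homotopic_paths WW (subpath 0 b (gap_path F) +++ subpath b v (gap_path F)) (subpath 0 v (gap_path F))"
    by (rule homotopic_join_subpaths1) (use pF v01 ab v in auto)
  moreover have "homotopic_paths WW (subpath 0 b (gap_path F) +++ subpath b v (gap_path F))
      (subpath 0 b upsilon_inf +++ subpath b v (gap_path E))"
    by (intro homotopic_paths_join homotopic_subpath_eq) (use pF v01 ab v Fu FE in auto)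
  ultimately have "homotopic_paths WW (subpath 0 v (gap_path F))
      (subpath 0 b upsilon_inf +++ subpath b v (gap_path E))"
    by (meson homotopic_paths_sym homotopic_paths_trans)
  then have 1: "W_equiv (subpath 0 v (gap_path F)) (subpath 0 b upsilon_inf +++ subpath b v (gap_path E))"
    by (rule W_equiv_homotopic) (use gap_path_0[OF Fg] in simp)
  have 2: "W_equiv (subpath 0 b upsilon_inf +++ subpath b v (gap_path E))
      ((subpath 0 a upsilon_inf +++ subpath a b lambda_inf) +++ subpath b v (gap_path E))"
    by (rule same_coset_join[OF W_equiv_gap[OF G(1)]])
      (use gap_path_piece[OF E ab(4) v01] Fu[of b] FE[of b] bd in auto)
  have "homotopic_paths WW ((subpath 0 a upsilon_inf +++ subpath a b lambda_inf) +++ subpath b v (gap_path E))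
      ((subpath 0 a (gap_path E) +++ subpath a b (gap_path E)) +++ subpath b v (gap_path E))"
    by (intro homotopic_paths_join homotopic_subpath_eq)
      (use path_upsilon_inf path_image_upsilon_inf path_lambda_inf path_image_lambda_inf_WW
        pE v01 ab v uE lE lE[of a] lE[of b] uE[of a] bd in auto)
  also have "homotopic_paths WW \<dots> (subpath 0 b (gap_path E) +++ subpath b v (gap_path E))"
    by (intro homotopic_paths_join homotopic_join_subpaths1)
      (use gap_path_piece[OF E ab(4) v01] pE v01 ab v in auto)
  also have "homotopic_paths WW \<dots> (subpath 0 v (gap_path E))"
    by (rule homotopic_join_subpaths1) (use pE v01 ab v in auto)
  finally have 3: "W_equiv ((subpath 0 a upsilon_inf +++ subpath a b lambda_inf) +++ subpath b v (gap_path E))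
      (subpath 0 v (gap_path E))"
    by (rule W_equiv_homotopic) (use gap_loop_pieces[OF G(1)] in simp)
  show ?thesis using W_equiv_trans[OF W_equiv_trans[OF 1 2] 3] .
qed

text \<open>
  Subdividing [0,v] at u loses at most one gap, namely one that contains u in its interior.
\<close>

lemma vertex_path_join:
  assumes uv: "0 \<le> u" "u \<le> v" "v \<le> 1"
  shows "W_equiv (vertex_path u +++ subpath u v (gap_path (gaps_within u v))) (vertex_path v)"
proof -
  have u01: "u \<in> {0..1}" "v \<in> {0..1}" using uv by auto
  define E where "E = gaps_within 0 u \<union> gaps_within u v"
  have E: "E \<subseteq> cantor_gaps" using gaps_within_subset by (auto simp: E_def)
  note sub = gaps_within_subset
  have Eu: "gap_path (gaps_within 0 u) t = gap_path E t" if "t \<le> u" for t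
    by (rule gap_path_eqI[OF sub E]) (use that in \<open>auto simp: E_def gaps_within_def\<close>)
  have Ev: "gap_path (gaps_within u v) t = gap_path E t" if "u \<le> t" for t
    by (rule gap_path_eqI[OF sub E]) (use that in \<open>auto simp: E_def gaps_within_def\<close>)
  have "homotopic_paths WW (vertex_path u +++ subpath u v (gap_path (gaps_within u v)))
      (subpath 0 u (gap_path E) +++ subpath u v (gap_path E))"
    unfolding vertex_path_def
    by (intro homotopic_paths_join homotopic_subpath_eq)
      (use path_gap_path[OF sub] path_image_gap_path[OF sub] u01 uv Eu Ev in auto)
  also have "homotopic_paths WW \<dots> (subpath 0 v (gap_path E))"
    by (rule homotopic_join_subpaths1) (use path_gap_path[OF E] path_image_gap_path[OF E] u01 uv in auto)
  finally have 1: "W_equiv (vertex_path u +++ subpath u v (gap_path (gaps_within u v))) (subpath 0 v (gap_path E))"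
    by (rule W_equiv_homotopic) (use vertex_path[OF u01(1)] in simp)
  show ?thesis
  proof (cases "\<exists>(a, b)\<in>cantor_gaps. a < u \<and> u < b \<and> b \<le> v")
    case True
    then obtain a b where ab: "(a, b) \<in> cantor_gaps" "a < u" "u < b" "b \<le> v" by auto
    have uniq: "(c, d) = (a, b)" if "(c, d) \<in> cantor_gaps" "c < u" "u < d" for c d
      using cantor_gaps_disjoint[OF ab(1) that(1), of u] ab that by auto
    have "(c, d) \<in> gaps_within 0 v \<longleftrightarrow> (c, d) \<in> insert (a, b) E" for c d
      using uniq[of c d] ab uv cantor_gap_bounds[of c d] cantor_gap_bounds[OF ab(1)]
      unfolding E_def gaps_within_def
      by (cases "d \<le> u"; cases "u \<le> c"; cases "(c, d) \<in> cantor_gaps") auto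
    then have eq: "gaps_within 0 v = insert (a, b) E" by (intro subset_antisym subrelI) blast+
    have "W_equiv (subpath 0 v (gap_path (gaps_within 0 v))) (subpath 0 v (gap_path E))"
      by (rule W_equiv_insert_gap[OF E eq ab(1) _ _ ab(4) uv(3)])
        (use ab cantor_gap_bounds in \<open>force simp: E_def gaps_within_def\<close>)+
    then show ?thesis using W_equiv_trans[OF 1 W_equiv_sym] by (simp add: vertex_path_def)
  next
    case False
    then have no: "\<not> (c < u \<and> u < d \<and> d \<le> v)" if "(c, d) \<in> cantor_gaps" for c d using that by auto
    have "(c, d) \<in> gaps_within 0 v \<longleftrightarrow> (c, d) \<in> E" for c d
      using no[of c d] uv cantor_gap_bounds[of c d] unfolding E_def gaps_within_def
      by (cases "d \<le> u"; cases "u \<le> c"; cases "(c, d) \<in> cantor_gaps") auto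
    then have "gaps_within 0 v = E" by (intro subset_antisym subrelI) blast+
    then show ?thesis using 1 by (simp add: vertex_path_def)
  qed
qed

lemma standard_path_ends:
  assumes "p \<in> standard_paths"
  obtains u v where "u \<in> {0..1}" "v \<in> {0..1}" "pathstart p = (u, 0)" "pathfinish p = (v, 0)"
proof -
  obtain n j where "(n, j) \<in> dyadic_index" "p = dyadic_path n j \<or> p = reversepath (dyadic_path n j)"
    using assms by (auto simp: standard_paths_def)
  moreover from this have "dyadic_left n j \<in> {0..1}" "dyadic_right n j \<in> {0..1}"
    using dyadic_index_bounds[of n j] by auto
  ultimately show thesis
    using that[of "dyadic_left n j" "dyadic_right n j"] that[of "dyadic_right n j" "dyadic_left n j"]
    by auto
qed

lemma D_to_W_path:
  assumes "path p" "path_image p \<subseteq> DD"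
  shows "path (D_to_W \<circ> p)" "path_image (D_to_W \<circ> p) \<subseteq> WW"
  using assms D_to_W_WW
  by (auto intro!: path_continuous_image continuous_on_subset[OF continuous_on_D_to_W]
      simp: path_image_compose)

lemma W_equiv_standard:
  assumes "p \<in> standard_paths" "pathstart p = (u, 0)" "pathfinish p = (v, 0)"
  shows "W_equiv (vertex_path u +++ (D_to_W \<circ> p)) (vertex_path v)"
proof -
  have forward: "W_equiv (vertex_path (dyadic_left n j) +++ (D_to_W \<circ> dyadic_path n j))
      (vertex_path (dyadic_right n j))" if nj: "(n, j) \<in> dyadic_index" for n j
  proof -
    let ?u = "dyadic_left n j" and ?v = "dyadic_right n j"
    have uv: "0 \<le> ?u" "?u \<le> ?v" "?v \<le> 1" "?u \<in> {0..1}" using dyadic_index_bounds[OF nj] by auto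
    have "homotopic_paths WW (vertex_path ?u +++ (D_to_W \<circ> dyadic_path n j))
        (vertex_path ?u +++ subpath ?u ?v (gap_path (gaps_within ?u ?v)))"
      by (intro homotopic_paths_join homotopic_paths_eq)
        (use vertex_path[OF uv(4)] D_to_W_path[OF path_dyadic_path path_image_dyadic_path[OF nj]]
          D_to_W_dyadic_path[OF nj] in \<open>auto simp: pathstart_compose D_to_W_base\<close>)
    then show ?thesis
      using W_equiv_trans[OF W_equiv_homotopic vertex_path_join[OF uv(1-3)]]
        vertex_path(3)[OF uv(4)] by simp
  qed
  obtain n j where nj: "(n, j) \<in> dyadic_index" "p = dyadic_path n j \<or> p = reversepath (dyadic_path n j)"
    using assms(1) by (auto simp: standard_paths_def)
  from nj(2) show ?thesis
  proof
    assume "p = dyadic_path n j"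
    then show ?thesis using forward[OF nj(1)] assms by auto
  next
    let ?l = "dyadic_path n j" and ?u = "dyadic_left n j" and ?v = "dyadic_right n j"
    assume p: "p = reversepath ?l"
    then have uv: "u = ?v" "v = ?u" using assms by auto
    have u01: "?u \<in> {0..1}" "?v \<in> {0..1}" using dyadic_index_bounds[OF nj(1)] by auto
    note l = D_to_W_path[OF path_dyadic_path path_image_dyadic_path[OF nj(1)]]
    have le: "pathstart (D_to_W \<circ> ?l) = (?u, 0)" "pathfinish (D_to_W \<circ> ?l) = (?v, 0)"
      by (auto simp: pathstart_compose pathfinish_compose D_to_W_base)
    \<comment> \<open>Traversed backwards, the arc undoes the forward relation.\<close>
    have 1: "W_equiv (vertex_path ?v +++ reversepath (D_to_W \<circ> ?l))
        ((vertex_path ?u +++ (D_to_W \<circ> ?l)) +++ reversepath (D_to_W \<circ> ?l))"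
      by (rule same_coset_join[OF W_equiv_sym[OF forward[OF nj(1)]]])
        (use l le vertex_path[OF u01(2)] in auto)
    have "homotopic_paths WW ((vertex_path ?u +++ (D_to_W \<circ> ?l)) +++ reversepath (D_to_W \<circ> ?l))
        (vertex_path ?u +++ ((D_to_W \<circ> ?l) +++ reversepath (D_to_W \<circ> ?l)))"
      by (rule homotopic_paths_sym, rule homotopic_paths_assoc) (use l le vertex_path[OF u01(1)] in auto)
    also have "homotopic_paths WW \<dots> (vertex_path ?u +++ linepath (?u, 0) (?u, 0))"
      using homotopic_paths_rinv[OF l] le vertex_path[OF u01(1)]
      by (intro homotopic_paths_join) auto
    also have "homotopic_paths WW \<dots> (vertex_path ?u)"
      by (rule homotopic_paths_rid') (use vertex_path[OF u01(1)] in auto)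
    finally have "W_equiv ((vertex_path ?u +++ (D_to_W \<circ> ?l)) +++ reversepath (D_to_W \<circ> ?l)) (vertex_path ?u)"
      by (rule W_equiv_homotopic) (use vertex_path[OF u01(1)] in simp)
    from W_equiv_trans[OF 1 this] show ?thesis
      by (simp add: p uv path_compose_reversepath)
  qed
qed

text \<open>
  By induction each standard path takes the coset of its initial vertex to that of its terminal vertex.
\<close>

lemma W_equiv_concatenation:
  assumes "p \<in> finite_concatenations" "pathstart p = (u, 0)" "pathfinish p = (v, 0)"
  shows "W_equiv (vertex_path u +++ (D_to_W \<circ> p)) (vertex_path v)"
  using assms
proof (induction arbitrary: u rule: finite_concatenations.induct)
  case (single p)
  then show ?case by (intro W_equiv_standard)
next
  case (join p q)
  obtain u' w where w: "u' \<in> {0..1}" "w \<in> {0..1}" "pathstart p = (u', 0)" "pathfinish p = (w, 0)"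
    using standard_path_ends[OF join(1)] by blast
  then have u: "u' = u" using join.prems by simp
  have q: "path q" "path_image q \<subseteq> DD" "pathstart q = (w, 0)"
    using finite_concatenation_path[OF join(2)] join(3) w by auto
  note hp = D_to_W_path[OF standard_path[OF join(1)]] and hq = D_to_W_path[OF q(1,2)]
  have ends: "pathstart (D_to_W \<circ> p) = (u, 0)" "pathfinish (D_to_W \<circ> p) = (w, 0)"
    "pathstart (D_to_W \<circ> q) = (w, 0)"
    using w q u by (auto simp: pathstart_compose pathfinish_compose D_to_W_base)
  note vu = vertex_path[OF w(1)[unfolded u]] and vw = vertex_path[OF w(2)]
  have "homotopic_paths WW (vertex_path u +++ ((D_to_W \<circ> p) +++ (D_to_W \<circ> q)))
      ((vertex_path u +++ (D_to_W \<circ> p)) +++ (D_to_W \<circ> q))"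
    by (rule homotopic_paths_assoc) (use hp hq ends vu in auto)
  then have 1: "W_equiv (vertex_path u +++ (D_to_W \<circ> (p +++ q)))
      ((vertex_path u +++ (D_to_W \<circ> p)) +++ (D_to_W \<circ> q))"
    unfolding path_compose_join by (rule W_equiv_homotopic) (use vu in simp)
  have 2: "W_equiv ((vertex_path u +++ (D_to_W \<circ> p)) +++ (D_to_W \<circ> q)) (vertex_path w +++ (D_to_W \<circ> q))"
    by (rule same_coset_join[OF W_equiv_standard[OF join(1)]]) (use w u hq ends in auto)
  have 3: "W_equiv (vertex_path w +++ (D_to_W \<circ> q)) (vertex_path v)"
    by (rule join.IH) (use q join.prems in auto)
  show ?case using W_equiv_trans[OF W_equiv_trans[OF 1 2] 3] .
qed

lemma D_to_W_D_subgroup: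
  assumes p: "p \<in> finite_concatenations" "p \<in> loops_at DD d0"
  shows "path_class WW (D_to_W \<circ> p) \<in> W_subgroup"
proof -
  have ends: "pathstart p = (0, 0)" "pathfinish p = (0, 0)" "path p" "path_image p \<subseteq> DD"
    using p(2) by (auto simp: loops_at_def d0_def)
  note hp = D_to_W_path[OF ends(3,4)]
  have hpe: "pathstart (D_to_W \<circ> p) = d0" "pathfinish (D_to_W \<circ> p) = d0"
    using ends by (auto simp: pathstart_compose pathfinish_compose D_to_W_base d0_def)
  have const: "vertex_path 0 = linepath d0 d0"
    unfolding vertex_path_def subpath_refl gap_path_0[OF gaps_within_subset] ..
  have "homotopic_paths WW (D_to_W \<circ> p) (linepath d0 d0 +++ (D_to_W \<circ> p))"
    by (rule homotopic_paths_sym, rule homotopic_paths_lid') (use hp hpe in auto)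
  from W_equiv_homotopic[OF this hpe(1)]
  have "W_equiv (D_to_W \<circ> p) (linepath d0 d0)"
    using W_equiv_trans W_equiv_concatenation[OF p(1) ends(1,2)] unfolding const by blast
  then have "path_class WW ((D_to_W \<circ> p) +++ linepath d0 d0) \<in> W_subgroup"
    by (simp add: same_coset_def)
  moreover have "path_class WW ((D_to_W \<circ> p) +++ linepath d0 d0) = path_class WW (D_to_W \<circ> p)"
    by (rule path_class_cong, rule homotopic_paths_rid') (use hp hpe in auto)
  ultimately show ?thesis by simp
qed

lemma D_to_W_d0: "D_to_W d0 = d0"
  by (simp add: d0_def D_to_W_base)

lemma d_inf_loop: "big_arc +++ reversepath lambda_inf \<in> loops_at DD d0"
proof (rule loops_atI)
  have ends: "pathfinish lambda_inf = (1, 0)" "pathstart lambda_inf = (0, 0)"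
    by (auto simp: pathstart_def pathfinish_def lambda_inf_def)
  show "path (big_arc +++ reversepath lambda_inf)" "pathstart (big_arc +++ reversepath lambda_inf) = d0"
    "pathfinish (big_arc +++ reversepath lambda_inf) = d0"
    using big_arc_ends ends path_lambda_inf by (auto simp: d0_def)
  have "path_image lambda_inf \<subseteq> DD" using path_image_lambda_inf DD_base by blast
  then show "path_image (big_arc +++ reversepath lambda_inf) \<subseteq> DD"
    using big_arc_DD big_arc_ends ends by (simp add: path_image_join)
qed

lemma D_to_W_d_inf: "path_class WW (D_to_W \<circ> (big_arc +++ reversepath lambda_inf)) = w_inf"
proof -
  have arc: "(D_to_W \<circ> big_arc) t = upsilon_inf t" if "t \<in> {0..1}" for t
    using D_to_W_dyadic_path[OF top_index(1) that] that
    by (simp add: top_ends gaps_within_all upsilon_inf_eq)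
  have 1: "homotopic_paths WW upsilon_inf (D_to_W \<circ> big_arc)"
    by (intro homotopic_paths_eq) (use path_upsilon_inf path_image_upsilon_inf arc in auto)
  have "D_to_W \<circ> lambda_inf = lambda_inf" by (auto simp: lambda_inf_def D_to_W_base)
  then have 2: "homotopic_paths WW lambda_inf (D_to_W \<circ> lambda_inf)"
    using path_lambda_inf path_image_lambda_inf_WW by simp
  have "homotopic_paths WW (upsilon_inf +++ reversepath lambda_inf)
      (D_to_W \<circ> (big_arc +++ reversepath lambda_inf))"
    unfolding path_compose_join path_compose_reversepath
    by (intro homotopic_paths_join homotopic_paths_reversepath_D 1 2)
      (simp add: pathfinish_def lambda_inf_def upsilon_inf_cantor cantor_set_ends)
  then show ?thesis unfolding w_inf_def by (rule path_class_cong[symmetric])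
qed

lemma closed_W_if_closed_D:
  assumes "closed_subgroup DD d0 D_subgroup d_inf X x0 H"
  shows "closed_subgroup WW d0 W_subgroup w_inf X x0 H"
proof (rule closed_subgroup_pullback[OF assms continuous_on_D_to_W D_to_W_WW D_to_W_d0 _ d_inf_def
      d_inf_loop D_to_W_d_inf[symmetric]])
  fix A assume "A \<in> D_subgroup"
  then show "\<exists>p\<in>loops_at DD d0. A = path_class DD p \<and> path_class WW (D_to_W \<circ> p) \<in> W_subgroup"
    unfolding D_subgroup_def using D_to_W_D_subgroup by blast
qed

lemma closed_D_iff_closed_W:
  "closed_subgroup DD d0 D_subgroup d_inf X x0 H \<longleftrightarrow> closed_subgroup WW d0 W_subgroup w_inf X x0 H"
  using closed_W_if_closed_D closed_D_if_closed_W by blast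

theorem theorem7p10:
  fixes X :: "'a::topological_space set" and x0 :: 'a
  assumes "path_connected X" and "x0 \<in> X"
    and "totally_path_disconnected (non_slsc_points X)"
    and "N \<lhd> fundamental_group X x0"
  shows "(closed_subgroup DD d0 D_subgroup d_inf X x0 N \<longleftrightarrow>
          closed_subgroup WW d0 W_subgroup w_inf X x0 N) \<and>
         subgroup_closure DD d0 D_subgroup d_inf X x0 N =
         subgroup_closure WW d0 W_subgroup w_inf X x0 N"
  by (simp add: closed_D_iff_closed_W subgroup_closure_def)

end
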